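(* Let $\phi\colon\mathbb{D}\to\mathbb{D}$ be an analytic self-map. There exists $w\in H^2$, $w\not\equiv0$, such that the weighted composition operator $M_wC_\phi\colon f\mapsto w\,(f\circ\phi)$ is a (bounded) Hilbert–Schmidt operator on $H^2$ if and only if $$\int_{\mathbb{T}}\log\Big(\frac{1}{1-|\phi^\ast|}\Big)\,dm<+\infty .$$
   Context: $\mathbb{D}$ is the open unit disk, $\mathbb{T}=\partial\mathbb{D}$, $m$ the normalized Lebesgue measure on $\mathbb{T}$, $H^2$ the Hardy space. $\phi^\ast(\xi)=\lim_{r\to1^-}\phi(r\xi)$ is the radial limit function of $\phi$, defined $m$-a.e.; the integrand is taken to be $+\infty$ where $|\phi^\ast|=1$. *)

theory Defs
  imports "HOL-Analysis.Analysis"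
begin

definition taylor_coeff :: "(complex \<Rightarrow> complex) \<Rightarrow> nat \<Rightarrow> complex" where
  "taylor_coeff f n = (deriv ^^ n) f 0 / of_nat (fact n)"

definition hardy2 :: "(complex \<Rightarrow> complex) \<Rightarrow> bool" where
  "hardy2 f \<longleftrightarrow> f holomorphic_on ball 0 1 \<and> summable (\<lambda>n. (cmod (taylor_coeff f n))^2)"

definition h2norm :: "(complex \<Rightarrow> complex) \<Rightarrow> real" where
  "h2norm f = sqrt (\<Sum>n. (cmod (taylor_coeff f n))^2)"

text \<open>M_w C_phi is a bounded Hilbert-Schmidt operator on H^2 (w.r.t. the orthonormal basis z^n).\<close>
definition wcomp_HS :: "(complex \<Rightarrow> complex) \<Rightarrow> (complex \<Rightarrow> complex) \<Rightarrow> bool" where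
  "wcomp_HS w \<phi> \<longleftrightarrow>
     (\<forall>f. hardy2 f \<longrightarrow> hardy2 (\<lambda>z. w z * f (\<phi> z))) \<and>
     (\<exists>C. \<forall>f. hardy2 f \<longrightarrow> h2norm (\<lambda>z. w z * f (\<phi> z)) \<le> C * h2norm f) \<and>
     summable (\<lambda>n. (h2norm (\<lambda>z. w z * (\<phi> z) ^ n))^2)"

definition radial_limit :: "(complex \<Rightarrow> complex) \<Rightarrow> real \<Rightarrow> complex" where
  "radial_limit \<phi> t = Lim (at_left 1) (\<lambda>r::real. \<phi> (complex_of_real r * cis t))"

definition has_radial_limit :: "(complex \<Rightarrow> complex) \<Rightarrow> real \<Rightarrow> bool" where
  "has_radial_limit \<phi> t \<longleftrightarrow> (\<exists>L. ((\<lambda>r::real. \<phi> (complex_of_real r * cis t)) \<longlongrightarrow> L) (at_left 1))"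

text \<open>Integrand log(1/(1-|phi^*|)), taken to be +infinity where |phi^*| = 1 (or where the
  radial limit fails to exist, a null set).\<close>
definition log_integrand :: "(complex \<Rightarrow> complex) \<Rightarrow> real \<Rightarrow> ennreal" where
  "log_integrand \<phi> t =
     (if has_radial_limit \<phi> t \<and> cmod (radial_limit \<phi> t) < 1
      then ennreal (ln (1 / (1 - cmod (radial_limit \<phi> t)))) else \<infinity>)"

definition circle_log_integral :: "(complex \<Rightarrow> complex) \<Rightarrow> ennreal" where
  "circle_log_integral \<phi> = (\<integral>\<^sup>+ t\<in>{0..2*pi}. log_integrand \<phi> t \<partial>lborel) / ennreal (2*pi)"

end

theory Submission
  imports Defs "HOL-Complex_Analysis.Complex_Analysis" "HOL-Probability.Probability_Measure"
begin

text \<open>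
  Write \<open>f\<^sup>*\<close> for the radial limits of \<open>f\<close> and \<open>\<mu>\<^sub>z\<close> for the harmonic measure of the disc at \<open>z\<close>.
  A function in \<open>H\<^sup>2\<close> is the Poisson integral of \<open>f\<^sup>*\<close>; multiplying it by an outer function yields
  Szego's inequality \<open>\<bar>w z\<bar>\<^sup>2 exp (\<integral> u d\<mu>\<^sub>z) \<le> \<integral> \<bar>w\<^sup>*\<bar>\<^sup>2 exp u d\<mu>\<^sub>z\<close> for bounded \<open>u\<close>. Choose \<open>z\<close> with
  \<open>w z \<noteq> 0\<close> and \<open>exp u = (1 + \<bar>\<phi>\<^sup>*\<bar>) (1 + \<bar>\<phi>\<^sup>*\<bar>\<^sup>2 + \<dots> + \<bar>\<phi>\<^sup>*\<bar>\<^sup>2\<^sup>N)\<close>. The right-hand side is then bounded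
  by a multiple of \<open>\<Sum> \<parallel>w \<phi>\<^sup>n\<parallel>\<^sup>2\<close>, while \<open>u\<close> increases to \<open>ln (1 / (1 - \<bar>\<phi>\<^sup>*\<bar>))\<close> as \<open>N\<close> grows, so that
  this function is integrable. Conversely, if it is integrable, let \<open>w\<close> be the outer function with
  \<open>\<bar>w\<^sup>*\<bar>\<^sup>2 = 1 - \<bar>\<phi>\<^sup>*\<bar>\<close>. Jensen's inequality for \<open>exp\<close> gives \<open>\<bar>w\<bar>\<^sup>2 \<le> 1 - \<bar>\<phi>\<bar>\<close> in the disc, hence
  \<open>\<Sum> \<bar>w \<phi>\<^sup>n\<bar>\<^sup>2 \<le> 1\<close>.
\<close>

section \<open>Measure-theoretic preliminaries\<close>

lemma integrable_scaleR_bounded: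
  fixes f :: "'a \<Rightarrow> 'b::{banach, second_countable_topology}"
  assumes f: "integrable M f" and h: "h \<in> borel_measurable M" "\<And>x. \<bar>h x\<bar> \<le> B"
  shows "integrable M (\<lambda>x. h x *\<^sub>R f x)"
proof (rule Bochner_Integration.integrable_bound)
  show "integrable M (\<lambda>x. B *\<^sub>R f x)"
    using f by (rule integrable_scaleR_right)
  show "AE x in M. norm (h x *\<^sub>R f x) \<le> norm (B *\<^sub>R f x)"
    unfolding norm_scaleR using order.trans[OF h(2) abs_ge_self]
    by (intro AE_I2 mult_right_mono) auto
qed (use f h in measurable)

lemma (in prob_space) norm_expectation_power2_le:
  fixes X :: "'a \<Rightarrow> 'b::{banach, second_countable_topology}"
  assumes X: "X \<in> borel_measurable M" "integrable M (\<lambda>x. (norm (X x))\<^sup>2)"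
  shows "(norm (expectation X))\<^sup>2 \<le> expectation (\<lambda>x. (norm (X x))\<^sup>2)"
proof -
  have int_norm: "integrable M (\<lambda>x. norm (X x))"
    by (rule square_integrable_imp_integrable[OF measurable_compose[OF X(1) borel_measurable_norm] X(2)])
  have "(norm (expectation X))\<^sup>2 \<le> (expectation (\<lambda>x. norm (X x)))\<^sup>2"
    by (rule power_mono[OF integral_norm_bound norm_ge_zero])
  also have "\<dots> \<le> expectation (\<lambda>x. (norm (X x))\<^sup>2)"
    using variance_positive[of "\<lambda>x. norm (X x)"] unfolding variance_eq[OF int_norm X(2)] by simp
  finally show ?thesis .
qed

lemma nn_integral_le_if_tendsto:
  fixes f :: "nat \<Rightarrow> 'a \<Rightarrow> ennreal"
  assumes meas: "\<And>k. f k \<in> borel_measurable M"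
    and lim: "AE x in M. (\<lambda>k. f k x) \<longlonglongrightarrow> g x"
    and bound: "eventually (\<lambda>k. (\<integral>\<^sup>+x. f k x \<partial>M) \<le> C) sequentially"
  shows "(\<integral>\<^sup>+x. g x \<partial>M) \<le> C"
proof -
  have "(\<integral>\<^sup>+x. g x \<partial>M) = (\<integral>\<^sup>+x. liminf (\<lambda>k. f k x) \<partial>M)"
    using lim by (intro nn_integral_cong_AE, eventually_elim) (simp add: lim_imp_Liminf)
  also have "\<dots> \<le> liminf (\<lambda>k. \<integral>\<^sup>+x. f k x \<partial>M)"
    by (rule nn_integral_liminf[OF meas])
  also have "\<dots> \<le> C"
    using bound by (rule Liminf_le[rotated]) simp
  finally show ?thesis .
qed

lemma L1_dist_limit_le:
  fixes s :: "nat \<Rightarrow> 'a \<Rightarrow> 'b::{banach, second_countable_topology}"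
  assumes int: "integrable M f" "\<And>k. integrable M (s k)" and meas: "g \<in> borel_measurable M"
    and lim: "AE x in M. (\<lambda>k. s k x) \<longlonglongrightarrow> g x"
    and bound: "eventually (\<lambda>k. (\<integral>x. norm (f x - s k x) \<partial>M) \<le> e) sequentially" and "0 \<le> e"
  shows "integrable M (\<lambda>x. f x - g x)" "(\<integral>x. norm (f x - g x) \<partial>M) \<le> e"
proof -
  have nn_le: "(\<integral>\<^sup>+x. ennreal (norm (f x - g x)) \<partial>M) \<le> ennreal e"
  proof (rule nn_integral_le_if_tendsto)
    show "AE x in M. (\<lambda>k. ennreal (norm (f x - s k x))) \<longlonglongrightarrow> ennreal (norm (f x - g x))"
      using lim by eventually_elim (intro tendsto_intros)
    show "eventually (\<lambda>k. (\<integral>\<^sup>+x. ennreal (norm (f x - s k x)) \<partial>M) \<le> ennreal e) sequentially"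
      using bound
    proof eventually_elim
      case (elim k)
      then show ?case
        using int by (subst nn_integral_eq_integral) (auto intro: ennreal_leI)
    qed
  qed (use int in measurable)
  then show int_diff: "integrable M (\<lambda>x. f x - g x)"
    using int(1) meas by (intro integrableI_bounded) (auto intro: le_less_trans)
  show "(\<integral>x. norm (f x - g x) \<partial>M) \<le> e"
    using nn_le \<open>0 \<le> e\<close> by (simp add: nn_integral_eq_integral[OF integrable_norm[OF int_diff]])
qed

lemma L1_complete:
  fixes s :: "nat \<Rightarrow> 'a \<Rightarrow> 'b::{banach, second_countable_topology}"
  assumes s: "\<And>n. integrable M (s n)"
    and Cauchy: "\<And>e. e > 0 \<Longrightarrow> \<exists>N. \<forall>i\<ge>N. \<forall>j\<ge>N. (\<integral>x. norm (s i x - s j x) \<partial>M) < e"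
  obtains g r where "integrable M g" "(\<lambda>n. \<integral>x. norm (s n x - g x) \<partial>M) \<longlonglongrightarrow> 0"
    "strict_mono r" "AE x in M. (\<lambda>k. s (r k) x) \<longlonglongrightarrow> g x"
proof -
  have [measurable]: "s n \<in> borel_measurable M" for n using s by simp
  obtain r where r: "strict_mono r" "AE x in M. Cauchy (\<lambda>i. s (r i) x)"
    using cauchy_L1_AE_cauchy_subseq[OF s Cauchy] by blast
  define g where "g x = lim (\<lambda>i. s (r i) x)" for x
  have g: "g \<in> borel_measurable M" unfolding g_def by measurable
  have lim: "AE x in M. (\<lambda>k. s (r k) x) \<longlonglongrightarrow> g x"
    using r(2) unfolding g_def
    by eventually_elim (simp add: Cauchy_convergent flip: convergent_LIMSEQ_iff)
  have L1_close: "\<exists>N. \<forall>n\<ge>N. integrable M (\<lambda>x. s n x - g x) \<and> (\<integral>x. norm (s n x - g x) \<partial>M) \<le> e"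
    if "e > 0" for e
  proof -
    obtain N where N: "\<And>i j. i \<ge> N \<Longrightarrow> j \<ge> N \<Longrightarrow> (\<integral>x. norm (s i x - s j x) \<partial>M) < e"
      using Cauchy[OF \<open>e > 0\<close>] by blast
    have "eventually (\<lambda>k. (\<integral>x. norm (s n x - s (r k) x) \<partial>M) \<le> e) sequentially" if "n \<ge> N" for n
      using eventually_ge_at_top[of N]
    proof eventually_elim
      case (elim k)
      then show ?case
        using N[OF \<open>n \<ge> N\<close>, of "r k"] seq_suble[OF r(1), of k] by simp
    qed
    then show ?thesis
      using L1_dist_limit_le[OF s s g lim, where e = e] \<open>e > 0\<close> by (intro exI[of _ N]) auto
  qed
  show thesis
  proof
    obtain n where "integrable M (\<lambda>x. s n x - g x)" using L1_close[of 1] by auto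
    from Bochner_Integration.integrable_diff[OF s[of n] this] show "integrable M g"
      by (simp only: diff_diff_eq2 add_diff_cancel_left')
    show "(\<lambda>n. \<integral>x. norm (s n x - g x) \<partial>M) \<longlonglongrightarrow> 0"
    proof (rule LIMSEQ_I)
      fix e :: real assume "0 < e"
      then show "\<exists>N. \<forall>n\<ge>N. norm ((\<integral>x. norm (s n x - g x) \<partial>M) - 0) < e"
        using L1_close[of "e/2"] by fastforce
    qed
  qed (use r lim in auto)
qed

lemma borel_measurable_lebesgue_on_AE:
  fixes f g :: "'a::euclidean_space \<Rightarrow> 'b::topological_space"
  assumes g: "g \<in> borel_measurable (lebesgue_on S)" and S: "S \<in> sets lebesgue"
    and AE_eq: "AE x in lebesgue_on S. g x = f x"
  shows "f \<in> borel_measurable (lebesgue_on S)"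
proof (rule measurableI)
  fix A :: "'b set" assume "A \<in> sets borel"
  then have "g -` A \<inter> S \<in> sets (lebesgue_on S)"
    using measurable_sets[OF g] by simp
  then have sets_g: "g -` A \<inter> S \<in> sets lebesgue"
    using S by (simp add: sets_restrict_space_iff)
  have "AE x in lebesgue. x \<in> S \<longrightarrow> g x = f x"
    using AE_eq S by (subst (asm) AE_restrict_space_iff) auto
  then have "AE x in lebesgue. x \<in> g -` A \<inter> S \<longleftrightarrow> x \<in> f -` A \<inter> S"
    by eventually_elim auto
  from completion.in_sets_AE[OF this sets_g] have "f -` A \<inter> S \<in> sets lebesgue"
    by simp
  then show "f -` A \<inter> space (lebesgue_on S) \<in> sets (lebesgue_on S)"
    using S by (simp add: sets_restrict_space_iff)
qed simp

section \<open>Harmonic measure on the circle\<close>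

abbreviation arc_length :: "real measure" where
  "arc_length \<equiv> lebesgue_on {0..2*pi}"

definition poisson_kernel :: "complex \<Rightarrow> real \<Rightarrow> real" where
  "poisson_kernel z t = (1 - (cmod z)\<^sup>2) / (cmod (cis t - z))\<^sup>2"

definition harmonic_measure :: "complex \<Rightarrow> real measure" where
  "harmonic_measure z = density arc_length (\<lambda>t. ennreal (poisson_kernel z t / (2*pi)))"

lemma poisson_kernel_0 [simp]: "poisson_kernel 0 t = 1"
  by (simp add: poisson_kernel_def)

lemma poisson_kernel_bounds:
  assumes "cmod z < 1"
  shows "(1 - cmod z) / (1 + cmod z) \<le> poisson_kernel z t"
    and "poisson_kernel z t \<le> (1 + cmod z) / (1 - cmod z)"
proof -
  let ?d = "cmod (cis t - z)"
  have dist_bounds: "1 - cmod z \<le> ?d" "?d \<le> 1 + cmod z"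
    using norm_triangle_ineq2[of "cis t" z] norm_triangle_ineq4[of "cis t" z] by simp_all
  have diff_squares: "1 - (cmod z)\<^sup>2 = (1 - cmod z) * (1 + cmod z)"
    by (simp add: power2_eq_square algebra_simps)
  have add_nonzero: "1 + cmod z \<noteq> 0"
    using norm_ge_zero[of z] by linarith
  have "(1 - cmod z) / (1 + cmod z) = (1 - (cmod z)\<^sup>2) / (1 + cmod z)\<^sup>2"
    using add_nonzero by (simp add: diff_squares) (simp add: power2_eq_square)
  also have "\<dots> \<le> poisson_kernel z t"
    unfolding poisson_kernel_def using dist_bounds assms
    by (intro frac_le power_mono) (auto simp: power_le_one)
  finally show "(1 - cmod z) / (1 + cmod z) \<le> poisson_kernel z t" .
  have "poisson_kernel z t \<le> (1 - (cmod z)\<^sup>2) / (1 - cmod z)\<^sup>2"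
    unfolding poisson_kernel_def using dist_bounds assms
    by (intro frac_le power_mono) (auto simp: power_le_one)
  also have "\<dots> = (1 + cmod z) / (1 - cmod z)"
    using assms by (simp add: diff_squares) (simp add: power2_eq_square)
  finally show "poisson_kernel z t \<le> (1 + cmod z) / (1 - cmod z)" .
qed

lemma poisson_kernel_pos:
  assumes "cmod z < 1"
  shows "0 < poisson_kernel z t"
proof -
  have "0 < (1 - cmod z) / (1 + cmod z)"
    using assms by (simp add: add_pos_nonneg)
  then show ?thesis
    using poisson_kernel_bounds(1)[OF assms] by (rule less_le_trans)
qed

lemma continuous_on_poisson_kernel:
  "cmod z < 1 \<Longrightarrow> continuous_on S (poisson_kernel z)"
  unfolding poisson_kernel_def by (intro continuous_intros) auto

lemma integrable_arc_length_continuous: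
  fixes f :: "real \<Rightarrow> 'a::euclidean_space"
  assumes "continuous_on {0..2*pi} f"
  shows "integrable arc_length f"
  by (intro absolutely_integrable_imp_integrable absolutely_integrable_continuous_real assms) auto

lemma integrable_arc_length_AE_bounded:
  fixes f :: "real \<Rightarrow> 'a::{banach, second_countable_topology}"
  assumes "f \<in> borel_measurable arc_length" "AE t in arc_length. norm (f t) \<le> B"
  shows "integrable arc_length f"
proof (rule Bochner_Integration.integrable_bound)
  show "integrable arc_length (\<lambda>t. B)"
    by (intro integrable_arc_length_continuous continuous_intros)
  show "AE t in arc_length. norm (f t) \<le> norm B"
    using assms(2) by eventually_elim simp
qed (rule assms(1))

lemma borel_measurable_arc_length_continuous:
  fixes f :: "real \<Rightarrow> 'a::topological_space"
  assumes "continuous_on {0..2*pi} f"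
  shows "f \<in> borel_measurable arc_length"
  using assms by (rule continuous_imp_measurable_on_sets_lebesgue) simp

lemma borel_measurable_poisson_kernel:
  "cmod z < 1 \<Longrightarrow> poisson_kernel z \<in> borel_measurable arc_length"
  by (intro borel_measurable_arc_length_continuous continuous_on_poisson_kernel)

lemma space_harmonic_measure [simp]: "space (harmonic_measure z) = {0..2*pi}"
  and sets_harmonic_measure [simp, measurable_cong]: "sets (harmonic_measure z) = sets arc_length"
  by (simp_all add: harmonic_measure_def)

lemma measurable_harmonic_measure [simp]: "measurable (harmonic_measure z) N
    = measurable arc_length N"
  by (rule measurable_cong_sets) simp_all

lemma AE_harmonic_measure_iff:
  assumes "cmod z < 1"
  shows "(AE t in harmonic_measure z. P t) \<longleftrightarrow> (AE t in arc_length. P t)"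
  unfolding harmonic_measure_def using borel_measurable_poisson_kernel[OF assms]
  by (subst AE_density) (auto simp: poisson_kernel_pos[OF assms])

lemma integral_harmonic_measure:
  fixes f :: "real \<Rightarrow> 'a::euclidean_space"
  assumes "cmod z < 1" "f \<in> borel_measurable arc_length"
  shows "(\<integral>t. f t \<partial>harmonic_measure z)
    = (1 / (2*pi)) *\<^sub>R (\<integral>t. poisson_kernel z t *\<^sub>R f t \<partial>arc_length)"
proof -
  have "(\<integral>t. f t \<partial>harmonic_measure z) = (\<integral>t. (poisson_kernel z t / (2*pi)) *\<^sub>R f t \<partial>arc_length)"
    unfolding harmonic_measure_def
    using assms borel_measurable_poisson_kernel[OF assms(1)]
      less_imp_le[OF poisson_kernel_pos[OF assms(1)]]
    by (intro integral_density) auto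
  also have "(\<lambda>t. (poisson_kernel z t / (2*pi)) *\<^sub>R f t)
      = (\<lambda>t. (1 / (2*pi)) *\<^sub>R (poisson_kernel z t *\<^sub>R f t))"
    by (simp add: fun_eq_iff)
  finally show ?thesis
    by (simp only: integral_scaleR_right)
qed

lemma integrable_poisson_kernel_scaleR:
  fixes f :: "real \<Rightarrow> 'a::euclidean_space"
  assumes z: "cmod z < 1" and f: "integrable arc_length f"
  shows "integrable arc_length (\<lambda>t. poisson_kernel z t *\<^sub>R f t)"
  using f borel_measurable_poisson_kernel[OF z]
proof (rule integrable_scaleR_bounded)
  show "\<bar>poisson_kernel z t\<bar> \<le> (1 + cmod z) / (1 - cmod z)" for t
    using poisson_kernel_bounds(2)[OF z, of t] poisson_kernel_pos[OF z, of t] by linarith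
qed

lemma integrable_poisson_kernel_scaleR_iff:
  fixes f :: "real \<Rightarrow> 'a::euclidean_space"
  assumes z: "cmod z < 1"
  shows "integrable arc_length (\<lambda>t. poisson_kernel z t *\<^sub>R f t) \<longleftrightarrow> integrable arc_length f"
proof
  let ?P = "poisson_kernel z"
  assume "integrable arc_length (\<lambda>t. ?P t *\<^sub>R f t)"
  then have "integrable arc_length (\<lambda>t. inverse (?P t) *\<^sub>R (?P t *\<^sub>R f t))"
  proof (rule integrable_scaleR_bounded)
    show "(\<lambda>t. inverse (?P t)) \<in> borel_measurable arc_length"
      using borel_measurable_poisson_kernel[OF z] by measurable
    have "0 < (1 - cmod z) / (1 + cmod z)"
      using z by (simp add: add_pos_nonneg)
    then show "\<bar>inverse (?P t)\<bar> \<le> inverse ((1 - cmod z) / (1 + cmod z))" for t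
      using le_imp_inverse_le[OF poisson_kernel_bounds(1)[OF z, of t]] poisson_kernel_pos[OF z, of t]
      by simp
  qed
  moreover have "inverse (?P t) *\<^sub>R (?P t *\<^sub>R f t) = f t" for t
    using poisson_kernel_pos[OF z, of t] by simp
  ultimately show "integrable arc_length f" by simp
qed (rule integrable_poisson_kernel_scaleR[OF z])

lemma integrable_harmonic_measure_iff:
  fixes f :: "real \<Rightarrow> 'a::euclidean_space"
  assumes z: "cmod z < 1"
  shows "integrable (harmonic_measure z) f \<longleftrightarrow> integrable arc_length f"
proof (cases "f \<in> borel_measurable arc_length")
  case True
  have "integrable (harmonic_measure z) f
      \<longleftrightarrow> integrable arc_length (\<lambda>t. (poisson_kernel z t / (2*pi)) *\<^sub>R f t)"
    unfolding harmonic_measure_def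
    using True borel_measurable_poisson_kernel[OF z] less_imp_le[OF poisson_kernel_pos[OF z]]
    by (intro integrable_density) auto
  also have "\<dots> \<longleftrightarrow> integrable arc_length (\<lambda>t. poisson_kernel z t *\<^sub>R f t)"
  proof
    assume "integrable arc_length (\<lambda>t. (poisson_kernel z t / (2*pi)) *\<^sub>R f t)"
    then have "integrable arc_length (\<lambda>t. (2*pi) *\<^sub>R ((poisson_kernel z t / (2*pi)) *\<^sub>R f t))"
      by (rule integrable_scaleR_right)
    then show "integrable arc_length (\<lambda>t. poisson_kernel z t *\<^sub>R f t)"
      unfolding scaleR_scaleR by simp
  next
    assume "integrable arc_length (\<lambda>t. poisson_kernel z t *\<^sub>R f t)"
    then have "integrable arc_length (\<lambda>t. (1 / (2*pi)) *\<^sub>R (poisson_kernel z t *\<^sub>R f t))"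
      by (rule integrable_scaleR_right)
    then show "integrable arc_length (\<lambda>t. (poisson_kernel z t / (2*pi)) *\<^sub>R f t)"
      unfolding scaleR_scaleR by simp
  qed
  also note integrable_poisson_kernel_scaleR_iff[OF z]
  finally show ?thesis .
next
  case False
  then show ?thesis
    using borel_measurable_integrable by (metis measurable_harmonic_measure)
qed

lemma integrable_harmonic_measure:
  fixes f :: "real \<Rightarrow> 'a::euclidean_space"
  shows "cmod z < 1 \<Longrightarrow> integrable arc_length f \<Longrightarrow> integrable (harmonic_measure z) f"
  by (simp add: integrable_harmonic_measure_iff)

lemma poisson_kernel_eq_Cauchy_kernel:
  "of_real (poisson_kernel a t) =
    of_real (1 - (cmod a)\<^sup>2) / (1 - cnj a * cis t) / (cis t - a) * cis t"
proof -
  have "of_real ((cmod (cis t - a))\<^sup>2) = (cis t - a) * (cnj (cis t) - cnj a)"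
    by (simp add: complex_norm_square del: of_real_power)
  moreover have "cnj (cis t) - cnj a = (1 - cnj a * cis t) / cis t"
    by (simp add: field_simps cis_cnj cis_mult)
  ultimately show ?thesis
    unfolding poisson_kernel_def of_real_divide by simp
qed

text \<open>Cauchy's formula
  for \<open>f z (1 - \<bar>a\<bar>\<^sup>2) / (1 - cnj a z)\<close>, a function that agrees with \<open>f\<close> at \<open>a\<close>.\<close>
lemma has_integral_Poisson:
  assumes f: "f holomorphic_on ball 0 R" "1 < R" and a: "cmod a < 1"
  shows "((\<lambda>t. of_real (poisson_kernel a t) * f (cis t)) has_integral of_real (2*pi) * f a) {0..2*pi}"
proof -
  define h where "h z = f z * (of_real (1 - (cmod a)\<^sup>2) / (1 - cnj a * z))" for z
  have denom_nonzero: "1 - cnj a * z \<noteq> 0" if "cmod z \<le> 1" for z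
  proof -
    have "cmod (cnj a * z) \<le> cmod a"
      using that by (simp add: norm_mult mult_left_le)
    then have "cnj a * z \<noteq> 1" using a by auto
    then show ?thesis by simp
  qed
  have "h holomorphic_on cball 0 1"
    unfolding h_def using denom_nonzero f
    by (intro holomorphic_intros holomorphic_on_subset[OF f(1)]) auto
  from Cauchy_integral_circlepath_simple[OF this, of a] a
  have "((\<lambda>u. h u / (u - a)) has_contour_integral (2 * of_real pi * \<i> * h a)) (circlepath 0 1)"
    by simp
  then have "((\<lambda>t. \<i> * (h (cis t) / (cis t - a) * cis t))
      has_integral (2 * of_real pi * \<i> * h a)) {0..2*pi}"
    unfolding circlepath_def
    by (subst (asm) has_contour_integral_part_circlepath_iff) (auto simp: mult_ac)
  from has_integral_mult_right[OF this, of "-\<i>"]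
  have "((\<lambda>t. h (cis t) / (cis t - a) * cis t) has_integral of_real (2*pi) * h a) {0..2*pi}"
    by (simp add: algebra_simps)
  moreover have "h (cis t) / (cis t - a) * cis t = of_real (poisson_kernel a t) * f (cis t)" for t
    unfolding poisson_kernel_eq_Cauchy_kernel h_def by simp
  moreover have "h a = f a"
  proof -
    have "complex_of_real (1 - (cmod a)\<^sup>2) = 1 - cnj a * a"
      using complex_norm_square[of a] by (simp add: mult.commute)
    then show ?thesis using denom_nonzero[of a] a unfolding h_def by simp
  qed
  ultimately show ?thesis by simp
qed

lemma integral_poisson_kernel:
  assumes "cmod z < 1"
  shows "(\<integral>t. poisson_kernel z t \<partial>arc_length) = 2*pi"
proof -
  have "((\<lambda>t. complex_of_real (poisson_kernel z t)) has_integral of_real (2*pi)) {0..2*pi}"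
    using has_integral_Poisson[of "\<lambda>_. 1" 2 z] assms by simp
  from has_integral_linear[OF this bounded_linear_Re]
  have "(poisson_kernel z has_integral 2*pi) {0..2*pi}"
    by (simp add: o_def)
  then show ?thesis
    using assms by (simp add: integral_unique lebesgue_integral_eq_integral
        integrable_arc_length_continuous continuous_on_poisson_kernel)
qed

lemma prob_space_harmonic_measure:
  assumes "cmod z < 1"
  shows "prob_space (harmonic_measure z)"
proof (rule prob_spaceI)
  have "integrable arc_length (\<lambda>t. poisson_kernel z t / (2*pi))"
    using assms
    by (intro integrable_divide integrable_arc_length_continuous continuous_on_poisson_kernel) auto
  moreover have "0 \<le> poisson_kernel z t / (2*pi)" for t
    using poisson_kernel_pos[OF assms, of t] by simp
  moreover have "(\<integral>t. poisson_kernel z t / (2*pi) \<partial>arc_length) = 1"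
    using integral_poisson_kernel[OF assms] by simp
  ultimately have "(\<integral>\<^sup>+t. ennreal (poisson_kernel z t / (2*pi)) \<partial>arc_length) = 1"
    by (subst nn_integral_eq_integral) auto
  moreover have "(\<lambda>t. ennreal (poisson_kernel z t / (2*pi))) \<in> borel_measurable arc_length"
    using borel_measurable_poisson_kernel[OF assms] by measurable
  ultimately show "emeasure (harmonic_measure z) (space (harmonic_measure z)) = 1"
    unfolding space_harmonic_measure harmonic_measure_def
    by (subst emeasure_density)
      (auto simp: nn_integral_restrict_space indicator_inter_arith[symmetric] mult.assoc)
qed

lemma Poisson_formula:
  assumes f: "f holomorphic_on ball 0 R" "1 < R" and z: "cmod z < 1"
  shows "(\<integral>t. f (cis t) \<partial>harmonic_measure z) = f z"
proof -
  have cont: "continuous_on {0..2*pi} (\<lambda>t. f (cis t))"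
    by (intro continuous_on_compose2[OF holomorphic_on_imp_continuous_on[OF f(1)]] continuous_intros)
       (use f(2) in auto)
  then have "integrable arc_length (\<lambda>t. of_real (poisson_kernel z t) * f (cis t))"
    by (intro integrable_arc_length_continuous continuous_intros continuous_on_poisson_kernel z)
  then have "(\<integral>t. of_real (poisson_kernel z t) * f (cis t) \<partial>arc_length) = of_real (2*pi) * f z"
    using has_integral_Poisson[OF f z] by (simp add: lebesgue_integral_eq_integral integral_unique)
  moreover have "(\<lambda>t. f (cis t)) \<in> borel_measurable arc_length"
    using cont by (rule borel_measurable_arc_length_continuous)
  ultimately show ?thesis
    using z by (simp add: integral_harmonic_measure scaleR_conv_of_real)
qed

lemma integral_harmonic_measure_le:
  fixes f :: "real \<Rightarrow> real"
  assumes z: "cmod z < 1" and f: "integrable arc_length f" "\<And>t. 0 \<le> f t"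
  shows "(\<integral>t. f t \<partial>harmonic_measure z)
    \<le> (1 + cmod z) / (1 - cmod z) * (\<integral>t. f t \<partial>harmonic_measure 0)"
proof -
  let ?B = "(1 + cmod z) / (1 - cmod z)"
  have "(\<integral>t. poisson_kernel z t * f t \<partial>arc_length) \<le> (\<integral>t. ?B * f t \<partial>arc_length)"
    using f integrable_poisson_kernel_scaleR[OF z f(1)] poisson_kernel_bounds(2)[OF z]
    by (intro integral_mono mult_right_mono) auto
  from divide_right_mono[OF this, of "2*pi"] show ?thesis
    using f z by (simp add: integral_harmonic_measure)
qed

section \<open>Radial limits of Poisson integrals\<close>

lemma eventually_at_left_1: "eventually (\<lambda>r. 0 < r \<and> r < 1) (at_left (1::real))"
  using eventually_at_left_real[of 0 1] by simp

lemma mono_times_integral_nonpos: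
  fixes K q :: "real \<Rightarrow> real"
  assumes q: "q integrable_on {a..b}" "\<And>x. x \<in> {a..b} \<Longrightarrow> integral {x..b} q \<le> 0"
    and K: "mono_on {a..b} K" "\<And>x. x \<in> {a..b} \<Longrightarrow> 0 \<le> K x" and "a \<le> b"
  shows "integral {a..b} (\<lambda>x. K x * q x) \<le> 0"
proof -
  obtain c where c: "c \<in> {a..b}"
    and mean_value: "integral {a..b} (\<lambda>x. K x * q x)
        = K a * integral {a..c} q + K b * integral {c..b} q"
    using second_mean_value_theorem[OF q(1) \<open>a \<le> b\<close>, of K] monotone_onD[OF K(1)] by auto
  have "integral {a..c} q = integral {a..b} q - integral {c..b} q"
    using Henstock_Kurzweil_Integration.integral_combine[of a c b q] c q(1) by simp
  then have "integral {a..b} (\<lambda>x. K x * q x)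
      = K a * integral {a..b} q + (K b - K a) * integral {c..b} q"
    unfolding mean_value by (simp add: right_diff_distrib left_diff_distrib)
  also have "\<dots> \<le> 0"
    using q(2)[of a] q(2)[OF c] K(2)[of a] monotone_onD[OF K(1), of a b] \<open>a \<le> b\<close>
    by (intro add_nonpos_nonpos mult_nonneg_nonpos) auto
  finally show ?thesis .
qed

lemma antimono_times_integral_nonpos:
  fixes K q :: "real \<Rightarrow> real"
  assumes q: "q integrable_on {a..b}" "\<And>x. x \<in> {a..b} \<Longrightarrow> integral {a..x} q \<le> 0"
    and K: "antimono_on {a..b} K" "\<And>x. x \<in> {a..b} \<Longrightarrow> 0 \<le> K x" and "a \<le> b"
  shows "integral {a..b} (\<lambda>x. K x * q x) \<le> 0"
proof -
  have "integral {-b..-a} (\<lambda>x. K (-x) * q (-x)) \<le> 0"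
  proof (rule mono_times_integral_nonpos)
    show "(\<lambda>x. q (-x)) integrable_on {-b..-a}"
      using q(1) by simp
    show "integral {x..-a} (\<lambda>x. q (-x)) \<le> 0" if "x \<in> {-b..-a}" for x
      using q(2)[of "-x"] that Henstock_Kurzweil_Integration.integral_reflect_real[of "-x" a q]
      by auto
    show "mono_on {-b..-a} (\<lambda>x. K (-x))"
      using monotone_onD[OF K(1)] by (intro monotone_onI) auto
  qed (use K \<open>a \<le> b\<close> in auto)
  then show ?thesis
    using Henstock_Kurzweil_Integration.integral_reflect_real[of b a "\<lambda>x. K x * q x"] by simp
qed

lemma right_averages_tendsto:
  fixes g :: "real \<Rightarrow> 'a::euclidean_space"
  assumes "g integrable_on {a..b}"
  obtains N where "negligible N"
    "\<And>t e. \<lbrakk>t \<in> {a<..<b} - N; 0 < e\<rbrakk> \<Longrightarrow>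
      \<exists>d>0. \<forall>h. 0 < h \<and> h < d \<longrightarrow> norm (integral {t..t+h} g - h *\<^sub>R g t) \<le> e * h"
proof -
  define G where "G x = (if x \<in> {a..b} then g x else 0)" for x
  have "G integrable_on cbox u v" for u v
    unfolding G_def
    by (subst integrable_restrict_Int) (auto intro: integrable_subinterval_real[OF assms])
  then obtain N where N: "negligible N"
    "\<And>x e. \<lbrakk>x \<notin> N; 0 < e\<rbrakk> \<Longrightarrow> \<exists>d>0. \<forall>h. 0 < h \<and> h < d \<longrightarrow> norm (integral {x..x+h} G /\<^sub>R h - G x) < e"
    using integrable_ccontinuous_explicit[of G] by auto
  show thesis
  proof
    fix t e :: real assume t: "t \<in> {a<..<b} - N" and "0 < e"
    then obtain d where d: "0 < d" "\<And>h. 0 < h \<Longrightarrow> h < d \<Longrightarrow> norm (integral {t..t+h} G /\<^sub>R h - G t) < e"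
      using N(2)[of t e] by auto
    show "\<exists>d>0. \<forall>h. 0 < h \<and> h < d \<longrightarrow> norm (integral {t..t+h} g - h *\<^sub>R g t) \<le> e * h"
    proof (intro exI conjI allI impI)
      show "0 < min d (b - t)" using d(1) t by auto
      fix h assume h: "0 < h \<and> h < min d (b - t)"
      then have G_eq: "integral {t..t+h} G = integral {t..t+h} g" "G t = g t"
        using t by (auto intro!: integral_cong simp: G_def)
      have "norm (integral {t..t+h} g - h *\<^sub>R g t) = norm (h *\<^sub>R (integral {t..t+h} g /\<^sub>R h - g t))"
        using h by (simp add: scaleR_diff_right)
      also have "\<dots> = h * norm (integral {t..t+h} g /\<^sub>R h - g t)" using h by simp
      also have "\<dots> \<le> e * h" using d(2)[of h] h unfolding G_eq by (simp add: mult.commute)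
      finally show "norm (integral {t..t+h} g - h *\<^sub>R g t) \<le> e * h" .
    qed
  qed (rule N(1))
qed

lemma left_averages_tendsto:
  fixes g :: "real \<Rightarrow> 'a::euclidean_space"
  assumes "g integrable_on {a..b}"
  obtains N where "negligible N"
    "\<And>t e. \<lbrakk>t \<in> {a<..<b} - N; 0 < e\<rbrakk> \<Longrightarrow>
      \<exists>d>0. \<forall>h. 0 < h \<and> h < d \<longrightarrow> norm (integral {t-h..t} g - h *\<^sub>R g t) \<le> e * h"
proof -
  have "(\<lambda>x. g (-x)) integrable_on {-b..-a}" using assms by simp
  then obtain N where N: "negligible N"
    "\<And>t e. \<lbrakk>t \<in> {-b<..<-a} - N; 0 < e\<rbrakk> \<Longrightarrow>
      \<exists>d>0. \<forall>h. 0 < h \<and> h < d \<longrightarrow> norm (integral {t..t+h} (\<lambda>x. g (-x)) - h *\<^sub>R g (-t)) \<le> e * h"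
    using right_averages_tendsto[of "\<lambda>x. g (-x)" "-b" "-a"] by metis
  show thesis
  proof
    show "negligible (uminus ` N)"
      using N(1)
      by (intro negligible_differentiable_image_negligible linear_imp_differentiable_on linear_uminus) auto
    fix t e :: real assume t: "t \<in> {a<..<b} - uminus ` N" and e: "0 < e"
    then have "- t \<in> {-b<..<-a} - N" by force
    moreover have "integral {-t..-t+h} (\<lambda>x. g (-x)) = integral {t-h..t} g" for h
      using Henstock_Kurzweil_Integration.integral_reflect_real[of t "t-h" g] by simp
    ultimately show "\<exists>d>0. \<forall>h. 0 < h \<and> h < d \<longrightarrow> norm (integral {t-h..t} g - h *\<^sub>R g t) \<le> e * h"
      using N(2)[of "-t", OF _ e] by simp
  qed
qed

lemma poisson_kernel_polar:
  "poisson_kernel (of_real r * cis t) s = (1 - r\<^sup>2) / (1 - 2 * r * cos (s - t) + r\<^sup>2)"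
proof -
  have "(cmod (cis s - of_real r * cis t))\<^sup>2 = (cmod (cis (s - t) - of_real r))\<^sup>2"
    using norm_mult[of "cis t" "cis (s - t) - of_real r"] by (simp add: algebra_simps cis_mult)
  also have "\<dots> = (cos (s - t) - r)\<^sup>2 + (sin (s - t))\<^sup>2"
    by (simp add: cmod_power2)
  also have "\<dots> = 1 - 2 * r * cos (s - t) + r\<^sup>2"
    using sin_cos_squared_add[of "s - t"] by (simp add: power2_diff)
  finally show ?thesis by (simp add: poisson_kernel_def norm_mult power_mult_distrib)
qed

lemma poisson_kernel_polar_mono:
  assumes r: "0 \<le> r" "r < 1" and cos: "cos (s - t) \<le> cos (s' - t)"
  shows "poisson_kernel (of_real r * cis t) s \<le> poisson_kernel (of_real r * cis t) s'"
proof -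
  have "0 < (1 - r)\<^sup>2" using r by simp
  also have "\<dots> \<le> 1 - 2 * r * cos (s' - t) + r\<^sup>2"
    using r mult_left_mono[of "cos (s' - t)" 1 "2 * r"] by (simp add: power2_diff)
  finally show ?thesis
    unfolding poisson_kernel_polar using r cos mult_left_mono[OF cos, of "2 * r"]
    by (intro divide_left_mono mult_pos_pos) (auto simp: power_le_one)
qed

lemma poisson_kernel_far_le:
  assumes r: "1/2 \<le> r" "r < 1" and \<delta>: "0 < \<delta>" "\<delta> \<le> \<bar>s - t\<bar>" "\<bar>s - t\<bar> \<le> 2*pi - \<delta>"
  shows "poisson_kernel (of_real r * cis t) s \<le> (1 - r\<^sup>2) / (1 - cos \<delta>)"
proof -
  have \<delta>_le_pi: "\<delta> \<le> pi" using \<delta> by linarith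
  have "cos (s - t) = cos \<bar>s - t\<bar>" by simp
  also have "\<dots> \<le> cos \<delta>"
  proof (cases "\<bar>s - t\<bar> \<le> pi")
    case True
    then show ?thesis using \<delta> by (intro cos_monotone_0_pi_le) auto
  next
    case False
    have "cos \<bar>s - t\<bar> = cos (2*pi - \<bar>s - t\<bar>)" by (simp add: cos_diff)
    also have "\<dots> \<le> cos \<delta>" using False \<delta> by (intro cos_monotone_0_pi_le) auto
    finally show ?thesis .
  qed
  finally have cos_le: "cos (s - t) \<le> cos \<delta>" .
  have "cos \<delta> < 1" using \<delta>(1) \<delta>_le_pi cos_monotone_0_pi[of 0 \<delta>] by simp
  moreover have "1 * (1 - cos (s - t)) \<le> 2 * r * (1 - cos (s - t))"
    using r by (intro mult_right_mono) auto
  then have "1 * (1 - cos (s - t)) + 0 \<le> 2 * r * (1 - cos (s - t)) + (1 - r)\<^sup>2"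
    by (intro add_mono) auto
  then have "1 - cos \<delta> \<le> 2 * r * (1 - cos (s - t)) + (1 - r)\<^sup>2"
    using cos_le by simp
  then have "1 - cos \<delta> \<le> 1 - 2 * r * cos (s - t) + r\<^sup>2"
    by (simp add: power2_diff algebra_simps)
  ultimately show ?thesis
    unfolding poisson_kernel_polar using r
    by (intro divide_left_mono mult_pos_pos) (auto simp: power_le_one)
qed

lemma Poisson_integral_near_nonpos:
  assumes q: "q integrable_on {t-\<delta>..t+\<delta>}" and \<delta>: "0 < \<delta>" "\<delta> \<le> pi" and r: "0 \<le> r" "r < 1"
  shows "(\<And>h. 0 < h \<Longrightarrow> h \<le> \<delta> \<Longrightarrow> integral {t..t+h} q \<le> 0) \<Longrightarrow>
      integral {t..t+\<delta>} (\<lambda>s. poisson_kernel (of_real r * cis t) s * q s) \<le> 0"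
    and "(\<And>h. 0 < h \<Longrightarrow> h \<le> \<delta> \<Longrightarrow> integral {t-h..t} q \<le> 0) \<Longrightarrow>
      integral {t-\<delta>..t} (\<lambda>s. poisson_kernel (of_real r * cis t) s * q s) \<le> 0"
proof -
  let ?P = "poisson_kernel (of_real r * cis t)"
  have kernel_nonneg: "0 \<le> ?P s" for s
    using poisson_kernel_pos[of "of_real r * cis t" s] r by (simp add: norm_mult)
  have integrable_on: "q integrable_on {t..t+\<delta>}" "q integrable_on {t-\<delta>..t}"
    using \<delta> by (auto intro: integrable_subinterval_real[OF q])
  show "integral {t..t+\<delta>} (\<lambda>s. ?P s * q s) \<le> 0"
    if right: "\<And>h. 0 < h \<Longrightarrow> h \<le> \<delta> \<Longrightarrow> integral {t..t+h} q \<le> 0"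
  proof (rule antimono_times_integral_nonpos)
    show "antimono_on {t..t+\<delta>} ?P"
      using r \<delta> by (intro monotone_onI poisson_kernel_polar_mono cos_monotone_0_pi_le) auto
    show "integral {t..x} q \<le> 0" if "x \<in> {t..t+\<delta>}" for x
      using right[of "x - t"] that by (cases "x = t") auto
  qed (use integrable_on kernel_nonneg \<delta> in auto)
  show "integral {t-\<delta>..t} (\<lambda>s. ?P s * q s) \<le> 0"
    if left: "\<And>h. 0 < h \<Longrightarrow> h \<le> \<delta> \<Longrightarrow> integral {t-h..t} q \<le> 0"
  proof (rule mono_times_integral_nonpos)
    show "mono_on {t-\<delta>..t} ?P"
      using r \<delta> by (intro monotone_onI poisson_kernel_polar_mono cos_monotone_minus_pi_0') auto
    show "integral {x..t} q \<le> 0" if "x \<in> {t-\<delta>..t}" for x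
      using left[of "t - x"] that by (cases "x = t") auto
  qed (use integrable_on kernel_nonneg \<delta> in auto)
qed

lemma Poisson_integral_far_le:
  fixes q :: "real \<Rightarrow> real"
  assumes r: "1/2 \<le> r" "r < 1" and \<delta>: "0 < \<delta>"
    and far: "\<And>s. s \<in> {a..b} \<Longrightarrow> \<delta> \<le> \<bar>s - t\<bar> \<and> \<bar>s - t\<bar> \<le> 2*pi - \<delta>"
    and int: "(\<lambda>s. poisson_kernel (of_real r * cis t) s * q s) integrable_on {a..b}"
      "(\<lambda>s. \<bar>q s\<bar>) integrable_on {a..b}"
  shows "integral {a..b} (\<lambda>s. poisson_kernel (of_real r * cis t) s * q s)
    \<le> (1 - r\<^sup>2) / (1 - cos \<delta>) * integral {a..b} (\<lambda>s. \<bar>q s\<bar>)"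
proof -
  let ?P = "poisson_kernel (of_real r * cis t)" and ?C = "(1 - r\<^sup>2) / (1 - cos \<delta>)"
  have "integral {a..b} (\<lambda>s. ?P s * q s) \<le> integral {a..b} (\<lambda>s. ?C * \<bar>q s\<bar>)"
  proof (rule integral_le[OF int(1)])
    fix s assume "s \<in> {a..b}"
    then have kernel_le: "?P s \<le> ?C"
      using r \<delta> far by (intro poisson_kernel_far_le) auto
    have "0 \<le> ?P s"
      using poisson_kernel_pos[of "of_real r * cis t" s] r by (simp add: norm_mult)
    then have "?P s * q s \<le> ?P s * \<bar>q s\<bar>" by (intro mult_left_mono) auto
    also have "\<dots> \<le> ?C * \<bar>q s\<bar>" using kernel_le by (rule mult_right_mono) simp
    finally show "?P s * q s \<le> ?C * \<bar>q s\<bar>" .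
  qed (intro integrable_on_mult_right int(2))
  then show ?thesis by simp
qed

text \<open>Near \<open>t\<close> the Poisson kernel is monotone on either side, so that the second mean value theorem
  transfers the sign of the averages; away from \<open>t\<close> it tends to \<open>0\<close> uniformly.\<close>
lemma Poisson_integral_le_far_integral:
  fixes q :: "real \<Rightarrow> real"
  assumes q: "integrable arc_length q" and \<delta>: "0 < \<delta>" "\<delta> \<le> t" "\<delta> \<le> 2*pi - t"
    and right: "\<And>h. 0 < h \<Longrightarrow> h \<le> \<delta> \<Longrightarrow> integral {t..t+h} q \<le> 0"
    and left: "\<And>h. 0 < h \<Longrightarrow> h \<le> \<delta> \<Longrightarrow> integral {t-h..t} q \<le> 0"
    and r: "1/2 \<le> r" "r < 1"
  shows "(\<integral>s. q s \<partial>harmonic_measure (of_real r * cis t)) \<le> (1 - r\<^sup>2) / (1 - cos \<delta>) *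
    (integral {0..t-\<delta>} (\<lambda>s. \<bar>q s\<bar>) + integral {t+\<delta>..2*pi} (\<lambda>s. \<bar>q s\<bar>)) / (2*pi)"
proof -
  let ?z = "of_real r * cis t" and ?C = "(1 - r\<^sup>2) / (1 - cos \<delta>)"
  let ?I = "\<lambda>a b. integral {a..b} (\<lambda>s. poisson_kernel ?z s * q s)"
  have z: "cmod ?z < 1" using r by (simp add: norm_mult)
  have integrable_on: "f integrable_on {a..b}" if "integrable arc_length f" "0 \<le> a" "b \<le> 2*pi"
    for f :: "real \<Rightarrow> real" and a b
    using that by (intro integrable_subinterval_real[OF integrable_on_lebesgue_on[OF that(1)]]) auto
  have Pq: "integrable arc_length (\<lambda>s. poisson_kernel ?z s * q s)"
    using integrable_poisson_kernel_scaleR[OF z q] by simp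
  have "?I 0 (2*pi) = ?I 0 (t-\<delta>) + (?I (t-\<delta>) t + (?I t (t+\<delta>) + ?I (t+\<delta>) (2*pi)))"
    using \<delta> by (simp add: Henstock_Kurzweil_Integration.integral_combine integrable_on[OF Pq])
  moreover have "?I (t-\<delta>) t \<le> 0" "?I t (t+\<delta>) \<le> 0"
    using r \<delta> integrable_on[OF q] right left by (intro Poisson_integral_near_nonpos; simp)+
  moreover have "?I 0 (t-\<delta>) \<le> ?C * integral {0..t-\<delta>} (\<lambda>s. \<bar>q s\<bar>)"
    "?I (t+\<delta>) (2*pi) \<le> ?C * integral {t+\<delta>..2*pi} (\<lambda>s. \<bar>q s\<bar>)"
    using r \<delta> integrable_on[OF Pq] integrable_on[OF integrable_abs[OF q]]
    by (intro Poisson_integral_far_le; auto)+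
  ultimately have "?I 0 (2*pi)
      \<le> ?C * (integral {0..t-\<delta>} (\<lambda>s. \<bar>q s\<bar>) + integral {t+\<delta>..2*pi} (\<lambda>s. \<bar>q s\<bar>))"
    by (simp only: distrib_left)
  from divide_right_mono[OF this, of "2*pi"] show ?thesis
    using q Pq by (simp add: integral_harmonic_measure[OF z] lebesgue_integral_eq_integral)
qed

lemma eventually_Poisson_integral_nonpos:
  fixes q :: "real \<Rightarrow> real"
  assumes q: "integrable arc_length q" and \<delta>: "0 < \<delta>" "\<delta> \<le> t" "\<delta> \<le> 2*pi - t"
    and right: "\<And>h. 0 < h \<Longrightarrow> h \<le> \<delta> \<Longrightarrow> integral {t..t+h} q \<le> 0"
    and left: "\<And>h. 0 < h \<Longrightarrow> h \<le> \<delta> \<Longrightarrow> integral {t-h..t} q \<le> 0"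
    and "0 < e"
  shows "eventually (\<lambda>r. (\<integral>s. q s \<partial>harmonic_measure (of_real r * cis t)) \<le> e) (at_left (1::real))"
proof -
  define A where "A = integral {0..t-\<delta>} (\<lambda>s. \<bar>q s\<bar>) + integral {t+\<delta>..2*pi} (\<lambda>s. \<bar>q s\<bar>)"
  have "((\<lambda>r. (1 - r\<^sup>2) / (1 - cos \<delta>) * A / (2*pi)) \<longlongrightarrow> (1 - 1\<^sup>2) / (1 - cos \<delta>) * A / (2*pi)) (at_left 1)"
    unfolding divide_inverse by (intro tendsto_intros)
  then have "eventually (\<lambda>r. (1 - r\<^sup>2) / (1 - cos \<delta>) * A / (2*pi) < e) (at_left 1)"
    using \<open>0 < e\<close> by (intro order_tendstoD(2)) auto
  moreover have "eventually (\<lambda>r. 1/2 < r \<and> r < 1) (at_left (1::real))"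
    using eventually_at_left_real[of "1/2" 1] by simp
  ultimately show ?thesis
  proof eventually_elim
    case (elim r)
    then have "(\<integral>s. q s \<partial>harmonic_measure (of_real r * cis t))
        \<le> (1 - r\<^sup>2) / (1 - cos \<delta>) * A / (2*pi)"
      unfolding A_def by (intro Poisson_integral_le_far_integral q \<delta> right left) auto
    with elim show ?case by linarith
  qed
qed

lemma eventually_Poisson_integral_le:
  assumes g: "integrable arc_length g" and t: "0 < t" "t < 2*pi" and d: "0 < d"
    and right: "\<And>h. 0 < h \<Longrightarrow> h < d \<Longrightarrow> integral {t..t+h} g \<le> c * h"
    and left: "\<And>h. 0 < h \<Longrightarrow> h < d \<Longrightarrow> integral {t-h..t} g \<le> c * h"
    and e: "0 < e"
  shows "eventually (\<lambda>r. (\<integral>s. g s \<partial>harmonic_measure (of_real r * cis t)) \<le> c + e) (at_left (1::real))"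
proof -
  have int_g: "g integrable_on {0..2*pi}"
    using g by (intro integrable_on_lebesgue_on) auto
  define \<delta> where "\<delta> = Min {d/2, t, 2*pi - t}"
  have \<delta>: "0 < \<delta>" "\<delta> < d" "\<delta> \<le> t" "\<delta> \<le> 2*pi - t" using d t by (auto simp: \<delta>_def)
  have integral_shift: "integral {a..b} (\<lambda>s. g s - c) = integral {a..b} g - (b - a) * c"
    if "0 \<le> a" "a \<le> b" "b \<le> 2*pi" for a b
    using that integrable_subinterval_real[OF int_g, of a b]
    by (subst Henstock_Kurzweil_Integration.integral_diff) auto
  have "eventually (\<lambda>r. (\<integral>s. g s - c \<partial>harmonic_measure (of_real r * cis t)) \<le> e) (at_left 1)"
  proof (rule eventually_Poisson_integral_nonpos)
    show "integrable arc_length (\<lambda>s. g s - c)"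
      using g by simp
    show "integral {t..t+h} (\<lambda>s. g s - c) \<le> 0" "integral {t-h..t} (\<lambda>s. g s - c) \<le> 0"
      if "0 < h" "h \<le> \<delta>" for h
      using right[of h] left[of h] that \<delta> t by (simp_all add: integral_shift mult.commute)
  qed (use \<delta> e in auto)
  moreover note eventually_at_left_1
  ultimately show ?thesis
  proof eventually_elim
    case (elim r)
    then have z: "cmod (of_real r * cis t) < 1" by (simp add: norm_mult)
    interpret prob_space "harmonic_measure (of_real r * cis t)"
      by (rule prob_space_harmonic_measure[OF z])
    show ?case
      using elim(1) integrable_harmonic_measure[OF z g] by (simp add: prob_space[simplified])
  qed
qed

lemma Poisson_integral_tendsto_if_averages_tendsto:
  fixes g :: "real \<Rightarrow> real"
  assumes g: "integrable arc_length g" and t: "0 < t" "t < 2*pi"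
    and right: "\<And>e. 0 < e \<Longrightarrow> \<exists>d>0. \<forall>h. 0 < h \<and> h < d \<longrightarrow> \<bar>integral {t..t+h} g - h * g t\<bar> \<le> e * h"
    and left: "\<And>e. 0 < e \<Longrightarrow> \<exists>d>0. \<forall>h. 0 < h \<and> h < d \<longrightarrow> \<bar>integral {t-h..t} g - h * g t\<bar> \<le> e * h"
  shows "((\<lambda>r. \<integral>s. g s \<partial>harmonic_measure (of_real r * cis t)) \<longlongrightarrow> g t) (at_left (1::real))"
proof (rule tendstoI)
  fix e :: real assume "0 < e"
  then have third_pos: "0 < e / 3" by simp
  obtain d1 d2 where "0 < d1" "0 < d2"
    and avg_right: "\<And>h. 0 < h \<Longrightarrow> h < d1 \<Longrightarrow> \<bar>integral {t..t+h} g - h * g t\<bar> \<le> e/3 * h"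
    and avg_left: "\<And>h. 0 < h \<Longrightarrow> h < d2 \<Longrightarrow> \<bar>integral {t-h..t} g - h * g t\<bar> \<le> e/3 * h"
    using right[OF third_pos] left[OF third_pos] by auto
  then have min_pos: "0 < min d1 d2" by simp
  have upper: "integral {t..t+h} g \<le> (g t + e/3) * h" "integral {t-h..t} g \<le> (g t + e/3) * h"
    and lower: "integral {t..t+h} (\<lambda>s. - g s) \<le> (- g t + e/3) * h"
      "integral {t-h..t} (\<lambda>s. - g s) \<le> (- g t + e/3) * h"
    if "0 < h" "h < min d1 d2" for h
    using avg_right[of h] avg_left[of h] that unfolding distrib_right abs_le_iff
    by (simp_all add: mult.commute)
  have "eventually (\<lambda>r. (\<integral>s. g s \<partial>harmonic_measure (of_real r * cis t)) \<le> g t + e/3 + e/3) (at_left 1)"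
    by (intro eventually_Poisson_integral_le[OF g t min_pos _ _ third_pos] upper)
  moreover have "eventually (\<lambda>r. (\<integral>s. - g s \<partial>harmonic_measure (of_real r * cis t))
      \<le> - g t + e/3 + e/3) (at_left 1)"
    by (intro eventually_Poisson_integral_le[OF integrable_minus[OF g] t min_pos _ _ third_pos] lower)
  ultimately show "eventually (\<lambda>r. dist (\<integral>s. g s \<partial>harmonic_measure (of_real r * cis t)) (g t) < e)
      (at_left 1)"
    by eventually_elim (use \<open>0 < e\<close> in \<open>auto simp: dist_real_def\<close>)
qed

lemma AE_arc_length_if_negligible:
  assumes "negligible N" "\<And>t. 0 < t \<Longrightarrow> t < 2*pi \<Longrightarrow> t \<notin> N \<Longrightarrow> P t"
  shows "AE t in arc_length. P t"
proof -
  have "negligible (N \<union> {0, 2*pi})"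
    using assms(1) by (intro negligible_Un) auto
  then have "AE t in lebesgue. t \<notin> N \<union> {0, 2*pi}"
    by (intro AE_not_in) (simp add: negligible_iff_null_sets)
  then have "AE t in lebesgue. t \<in> {0..2*pi} \<longrightarrow> P t"
    by eventually_elim (use assms(2) in force)
  then show ?thesis
    by (subst AE_restrict_space_iff) auto
qed

theorem Fatou_Poisson_integral_real:
  fixes g :: "real \<Rightarrow> real"
  assumes g: "integrable arc_length g"
  shows "AE t in arc_length.
    ((\<lambda>r. \<integral>s. g s \<partial>harmonic_measure (of_real r * cis t)) \<longlongrightarrow> g t) (at_left (1::real))"
proof -
  have int_g: "g integrable_on {0..2*pi}"
    using g by (intro integrable_on_lebesgue_on) auto
  obtain N where N: "negligible N"
    "\<And>t e. \<lbrakk>t \<in> {0<..<2*pi} - N; 0 < e\<rbrakk> \<Longrightarrow>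
      \<exists>d>0. \<forall>h. 0 < h \<and> h < d \<longrightarrow> norm (integral {t..t+h} g - h *\<^sub>R g t) \<le> e * h"
    using right_averages_tendsto[OF int_g] by blast
  obtain N' where N': "negligible N'"
    "\<And>t e. \<lbrakk>t \<in> {0<..<2*pi} - N'; 0 < e\<rbrakk> \<Longrightarrow>
      \<exists>d>0. \<forall>h. 0 < h \<and> h < d \<longrightarrow> norm (integral {t-h..t} g - h *\<^sub>R g t) \<le> e * h"
    using left_averages_tendsto[OF int_g] by blast
  show ?thesis
  proof (rule AE_arc_length_if_negligible)
    show "negligible (N \<union> N')" using N(1) N'(1) by (rule negligible_Un)
    fix t assume "0 < t" "t < 2*pi" "t \<notin> N \<union> N'"
    then show "((\<lambda>r. \<integral>s. g s \<partial>harmonic_measure (of_real r * cis t)) \<longlongrightarrow> g t) (at_left 1)"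
      using N(2)[of t] N'(2)[of t] by (intro Poisson_integral_tendsto_if_averages_tendsto g) auto
  qed
qed

theorem Fatou_Poisson_integral:
  fixes g :: "real \<Rightarrow> complex"
  assumes g: "integrable arc_length g"
  shows "AE t in arc_length.
    ((\<lambda>r. \<integral>s. g s \<partial>harmonic_measure (of_real r * cis t)) \<longlongrightarrow> g t) (at_left (1::real))"
  using Fatou_Poisson_integral_real[OF integrable_Re[OF g]]
    Fatou_Poisson_integral_real[OF integrable_Im[OF g]]
proof eventually_elim
  case (elim t)
  have int_g: "integrable (harmonic_measure (of_real r * cis t)) g" if "0 < r \<and> r < 1" for r
    using that by (intro integrable_harmonic_measure g) (simp add: norm_mult)
  show ?case
    unfolding tendsto_complex_iff
  proof
    show "((\<lambda>r. Re (\<integral>s. g s \<partial>harmonic_measure (of_real r * cis t))) \<longlongrightarrow> Re (g t)) (at_left 1)"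
      using elim(1) by (rule Lim_transform_eventually)
        (use eventually_at_left_1 in eventually_elim, simp add: int_g)
    show "((\<lambda>r. Im (\<integral>s. g s \<partial>harmonic_measure (of_real r * cis t))) \<longlongrightarrow> Im (g t)) (at_left 1)"
      using elim(2) by (rule Lim_transform_eventually)
        (use eventually_at_left_1 in eventually_elim, simp add: int_g)
  qed
qed

section \<open>Boundary values of functions in the Hardy space\<close>

lemma continuous_on_circle:
  assumes "continuous_on (ball 0 R) f" "0 \<le> r" "r < R"
  shows "continuous_on S (\<lambda>t. f (of_real r * cis t))"
  by (intro continuous_on_compose2[OF assms(1)] continuous_intros)
    (use assms in \<open>auto simp: norm_mult\<close>)

lemma integrable_harmonic_measure_continuous:
  fixes f :: "real \<Rightarrow> 'a::euclidean_space"
  assumes "cmod z < 1" "continuous_on {0..2*pi} f"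
  shows "integrable (harmonic_measure z) f"
  using assms by (intro integrable_harmonic_measure integrable_arc_length_continuous)

lemma Parseval_polynomial:
  fixes c :: "nat \<Rightarrow> complex"
  shows "(\<integral>t. (cmod (\<Sum>n<N. c n * cis t ^ n))\<^sup>2 \<partial>harmonic_measure 0) = (\<Sum>n<N. (cmod (c n))\<^sup>2)"
proof (induction N arbitrary: c)
  case (Suc N)
  interpret prob_space "harmonic_measure 0" by (rule prob_space_harmonic_measure) simp
  define q where "q z = (\<Sum>n<N. c (Suc n) * z ^ n)" for z
  have Horner: "(cmod (\<Sum>n<Suc N. c n * cis t ^ n))\<^sup>2 =
      (cmod (c 0))\<^sup>2 + ((cmod (q (cis t)))\<^sup>2 + Re (2 * cnj (c 0) * (cis t * q (cis t))))" for t
  proof -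
    have "(\<Sum>n<Suc N. c n * cis t ^ n) = c 0 + cis t * q (cis t)"
      by (simp only: sum.lessThan_Suc_shift) (simp add: q_def sum_distrib_left mult_ac)
    moreover have "(cmod (a + b))\<^sup>2 = (cmod a)\<^sup>2 + (cmod b)\<^sup>2 + Re (2 * cnj a * b)" for a b
      by (simp add: cmod_power2) (simp add: power2_eq_square algebra_simps)
    ultimately show ?thesis by (simp add: norm_mult)
  qed
  have "(\<integral>t. 2 * cnj (c 0) * (cis t * q (cis t)) \<partial>harmonic_measure 0) = 0"
    using Poisson_formula[of "\<lambda>z. 2 * cnj (c 0) * (z * q z)" 2 0]
    by (simp add: q_def holomorphic_intros)
  moreover have int_q: "integrable (harmonic_measure 0) (\<lambda>t. 2 * cnj (c 0) * (cis t * q (cis t)))"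
    "integrable (harmonic_measure 0) (\<lambda>t. (cmod (q (cis t)))\<^sup>2)"
    unfolding q_def by (intro integrable_harmonic_measure_continuous continuous_intros; simp)+
  ultimately have "(\<integral>t. Re (2 * cnj (c 0) * (cis t * q (cis t))) \<partial>harmonic_measure 0) = 0"
    by (simp only: integral_Re) simp
  moreover have "(\<integral>t. (cmod (q (cis t)))\<^sup>2 \<partial>harmonic_measure 0) = (\<Sum>n<N. (cmod (c (Suc n)))\<^sup>2)"
    unfolding q_def by (rule Suc.IH)
  ultimately have "(\<integral>t. (cmod (\<Sum>n<Suc N. c n * cis t ^ n))\<^sup>2 \<partial>harmonic_measure 0) =
      (cmod (c 0))\<^sup>2 + (\<Sum>n<N. (cmod (c (Suc n)))\<^sup>2)"
    unfolding Horner using int_q by (simp add: prob_space[simplified] del: times_complex.simps)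
  also have "\<dots> = (\<Sum>n<Suc N. (cmod (c n))\<^sup>2)"
    by (simp only: sum.lessThan_Suc_shift)
  finally show ?case .
qed simp

lemma taylor_coeff_sums:
  assumes "f holomorphic_on ball 0 R" "cmod z < R"
  shows "(\<lambda>n. taylor_coeff f n * z ^ n) sums f z"
  using holomorphic_power_series[of f 0 R z] assms by (simp add: taylor_coeff_def)

lemma h2norm_sums:
  assumes "hardy2 f"
  shows "(\<lambda>n. (cmod (taylor_coeff f n))\<^sup>2) sums (h2norm f)\<^sup>2"
  using assms by (auto simp: hardy2_def h2norm_def sums_iff suminf_nonneg)

lemma h2norm_nonneg: "hardy2 f \<Longrightarrow> 0 \<le> h2norm f"
  by (simp add: hardy2_def h2norm_def suminf_nonneg)

definition taylor_poly :: "(complex \<Rightarrow> complex) \<Rightarrow> nat \<Rightarrow> complex \<Rightarrow> complex" where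
  "taylor_poly f N z = (\<Sum>n<N. taylor_coeff f n * z ^ n)"

lemma taylor_poly_tendsto:
  assumes "f holomorphic_on ball 0 R" "cmod z < R"
  shows "(\<lambda>N. taylor_poly f N z) \<longlonglongrightarrow> f z"
  using taylor_coeff_sums[OF assms] by (simp add: taylor_poly_def sums_def)

lemma holomorphic_on_taylor_poly: "taylor_poly f N holomorphic_on S"
  unfolding taylor_poly_def by (intro holomorphic_intros)

lemma continuous_on_taylor_poly_cis: "continuous_on S (\<lambda>t. taylor_poly f N (cis t))"
  unfolding taylor_poly_def by (intro continuous_intros)

lemma Parseval_taylor_poly_diff:
  assumes "i \<le> j"
  shows "(\<integral>t. (cmod (taylor_poly f j (cis t) - taylor_poly f i (cis t)))\<^sup>2 \<partial>harmonic_measure 0)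
    = (\<Sum>n=i..<j. (cmod (taylor_coeff f n))\<^sup>2)"
proof -
  have diff_eq: "taylor_poly f j z - taylor_poly f i z =
      (\<Sum>n<j. (if n < i then 0 else taylor_coeff f n) * z ^ n)" for z
  proof -
    have "taylor_poly f j z - taylor_poly f i z = (\<Sum>n=i..<j. taylor_coeff f n * z ^ n)"
      using sum.atLeastLessThan_concat[OF le0 assms, of "\<lambda>n. taylor_coeff f n * z ^ n"]
      by (simp add: taylor_poly_def algebra_simps flip: atLeast0LessThan)
    also have "\<dots> = (\<Sum>n<j. (if n < i then 0 else taylor_coeff f n) * z ^ n)"
      by (rule sum.mono_neutral_cong_left) auto
    finally show ?thesis .
  qed
  have "(\<integral>t. (cmod (taylor_poly f j (cis t) - taylor_poly f i (cis t)))\<^sup>2 \<partial>harmonic_measure 0)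
      = (\<Sum>n<j. (cmod (if n < i then 0 else taylor_coeff f n))\<^sup>2)"
    unfolding diff_eq by (rule Parseval_polynomial)
  also have "\<dots> = (\<Sum>n=i..<j. (cmod (taylor_coeff f n))\<^sup>2)"
    by (rule sum.mono_neutral_cong_right) auto
  finally show ?thesis .
qed

lemma taylor_poly_L1_dist_le:
  assumes "i \<le> j"
  shows "(\<integral>t. cmod (taylor_poly f j (cis t) - taylor_poly f i (cis t)) \<partial>harmonic_measure 0)\<^sup>2
    \<le> (\<Sum>n=i..<j. (cmod (taylor_coeff f n))\<^sup>2)"
proof -
  interpret prob_space "harmonic_measure 0" by (rule prob_space_harmonic_measure) simp
  let ?d = "\<lambda>t. cmod (taylor_poly f j (cis t) - taylor_poly f i (cis t))"
  have int: "integrable arc_length ?d" "integrable arc_length (\<lambda>t. (?d t)\<^sup>2)"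
    by (intro integrable_arc_length_continuous continuous_intros continuous_on_taylor_poly_cis)+
  have "(norm (expectation ?d))\<^sup>2 \<le> expectation (\<lambda>t. (norm (?d t))\<^sup>2)"
  proof (rule norm_expectation_power2_le)
    show "?d \<in> borel_measurable (harmonic_measure 0)"
      using borel_measurable_integrable[OF int(1)] by simp
    show "integrable (harmonic_measure 0) (\<lambda>t. (norm (?d t))\<^sup>2)"
      using int(2) by (simp add: integrable_harmonic_measure)
  qed
  also have "\<dots> = (\<Sum>n=i..<j. (cmod (taylor_coeff f n))\<^sup>2)"
    using Parseval_taylor_poly_diff[OF assms] by simp
  finally show ?thesis by simp
qed

lemma taylor_poly_L1_Cauchy:
  assumes f: "hardy2 f" and "e > 0"
  shows "\<exists>N. \<forall>i\<ge>N. \<forall>j\<ge>N.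
    (\<integral>t. cmod (taylor_poly f i (cis t) - taylor_poly f j (cis t)) \<partial>harmonic_measure 0) < e"
proof -
  let ?D = "\<lambda>i j. \<integral>t. cmod (taylor_poly f i (cis t) - taylor_poly f j (cis t)) \<partial>harmonic_measure 0"
  have "summable (\<lambda>n. (cmod (taylor_coeff f n))\<^sup>2)"
    using f by (simp add: hardy2_def)
  moreover have "0 < e\<^sup>2" using \<open>e > 0\<close> by simp
  ultimately obtain N where N: "\<And>i j. N \<le> i \<Longrightarrow> norm (\<Sum>n=i..<j. (cmod (taylor_coeff f n))\<^sup>2) < e\<^sup>2"
    unfolding summable_Cauchy by blast
  have ordered: "?D j i < e" if "N \<le> i" "i \<le> j" for i j
  proof (rule power2_less_imp_less)
    show "(?D j i)\<^sup>2 < e\<^sup>2"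
      using taylor_poly_L1_dist_le[OF \<open>i \<le> j\<close>, of f] N[OF \<open>N \<le> i\<close>, of j] by simp
  qed (use \<open>e > 0\<close> in simp)
  have "?D i j < e" if "N \<le> i" "N \<le> j" for i j
    using ordered[of i j] ordered[of j i] that by (cases "i \<le> j") (auto simp: norm_minus_commute)
  then show ?thesis by (intro exI[of _ N] allI impI)
qed

lemma integral_harmonic_measure_tendsto:
  fixes s :: "nat \<Rightarrow> real \<Rightarrow> complex"
  assumes z: "cmod z < 1" and int: "\<And>n. integrable arc_length (s n)" "integrable arc_length g"
    and lim: "(\<lambda>n. \<integral>t. cmod (s n t - g t) \<partial>harmonic_measure 0) \<longlonglongrightarrow> 0"
  shows "(\<lambda>n. \<integral>t. s n t \<partial>harmonic_measure z) \<longlonglongrightarrow> (\<integral>t. g t \<partial>harmonic_measure z)"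
proof (rule LIM_zero_cancel, rule Lim_null_comparison)
  let ?B = "(1 + cmod z) / (1 - cmod z)"
  show "eventually (\<lambda>n. norm ((\<integral>t. s n t \<partial>harmonic_measure z) - (\<integral>t. g t \<partial>harmonic_measure z))
      \<le> ?B * (\<integral>t. cmod (s n t - g t) \<partial>harmonic_measure 0)) sequentially"
  proof (rule always_eventually, rule allI)
    fix n
    have "(\<integral>t. s n t \<partial>harmonic_measure z) - (\<integral>t. g t \<partial>harmonic_measure z)
        = (\<integral>t. s n t - g t \<partial>harmonic_measure z)"
      using int
      by (intro Bochner_Integration.integral_diff[symmetric] integrable_harmonic_measure z)
    also have "norm \<dots> \<le> (\<integral>t. cmod (s n t - g t) \<partial>harmonic_measure z)"
      by (rule integral_norm_bound)
    also have "\<dots> \<le> ?B * (\<integral>t. cmod (s n t - g t) \<partial>harmonic_measure 0)"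
      using int by (intro integral_harmonic_measure_le z) auto
    finally show "norm ((\<integral>t. s n t \<partial>harmonic_measure z) - (\<integral>t. g t \<partial>harmonic_measure z))
      \<le> ?B * (\<integral>t. cmod (s n t - g t) \<partial>harmonic_measure 0)" .
  qed
  show "(\<lambda>n. ?B * (\<integral>t. cmod (s n t - g t) \<partial>harmonic_measure 0)) \<longlonglongrightarrow> 0"
    using tendsto_mult_right_zero[OF lim] .
qed

lemma nn_integral_taylor_poly_sq_le:
  assumes "hardy2 f"
  shows "(\<integral>\<^sup>+t. ennreal ((cmod (taylor_poly f N (cis t)))\<^sup>2) \<partial>harmonic_measure 0)
    \<le> ennreal ((h2norm f)\<^sup>2)"
proof -
  have "(\<integral>t. (cmod (taylor_poly f N (cis t)))\<^sup>2 \<partial>harmonic_measure 0)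
      = (\<Sum>n<N. (cmod (taylor_coeff f n))\<^sup>2)"
    unfolding taylor_poly_def by (rule Parseval_polynomial)
  also have "\<dots> \<le> (h2norm f)\<^sup>2"
    using sum_le_suminf[OF sums_summable[OF h2norm_sums[OF assms]], of "{..<N}"]
      sums_unique[OF h2norm_sums[OF assms]] by simp
  finally show ?thesis
    using continuous_on_taylor_poly_cis
    by (subst nn_integral_eq_integral)
      (auto intro!: ennreal_leI integrable_harmonic_measure_continuous continuous_intros)
qed

lemma hardy2_boundary_function:
  assumes f: "hardy2 f"
  obtains g :: "real \<Rightarrow> complex" where "integrable arc_length g"
    "\<And>z. cmod z < 1 \<Longrightarrow> (\<integral>t. g t \<partial>harmonic_measure z) = f z"
    "integrable arc_length (\<lambda>t. (cmod (g t))\<^sup>2)"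
    "(\<integral>t. (cmod (g t))\<^sup>2 \<partial>harmonic_measure 0) \<le> (h2norm f)\<^sup>2"
proof -
  let ?\<mu> = "harmonic_measure 0" and ?s = "\<lambda>n t. taylor_poly f n (cis t)"
  have cont: "continuous_on {0..2*pi} (?s n)" for n
    by (rule continuous_on_taylor_poly_cis)
  then have [measurable]: "?s n \<in> borel_measurable arc_length" for n
    by (rule borel_measurable_arc_length_continuous)
  obtain g r where g: "integrable ?\<mu> g" "(\<lambda>n. \<integral>t. cmod (?s n t - g t) \<partial>?\<mu>) \<longlonglongrightarrow> 0"
    and r: "strict_mono r" "AE t in ?\<mu>. (\<lambda>k. ?s (r k) t) \<longlonglongrightarrow> g t"
    by (rule L1_complete[OF integrable_harmonic_measure_continuous[OF _ cont]
          taylor_poly_L1_Cauchy[OF f]]) simp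
  have g_arc: "integrable arc_length g"
    using g(1) by (simp add: integrable_harmonic_measure_iff)
  have Poisson: "(\<integral>t. g t \<partial>harmonic_measure z) = f z" if z: "cmod z < 1" for z
  proof (rule LIMSEQ_unique)
    show "(\<lambda>n. taylor_poly f n z) \<longlonglongrightarrow> f z"
      using f z by (intro taylor_poly_tendsto) (auto simp: hardy2_def)
    have "(\<lambda>n. \<integral>t. ?s n t \<partial>harmonic_measure z) \<longlonglongrightarrow> (\<integral>t. g t \<partial>harmonic_measure z)"
      by (intro integral_harmonic_measure_tendsto z g_arc g(2) integrable_arc_length_continuous cont)
    then show "(\<lambda>n. taylor_poly f n z) \<longlonglongrightarrow> (\<integral>t. g t \<partial>harmonic_measure z)"
      using Poisson_formula[OF holomorphic_on_taylor_poly _ z, of 2] by simp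
  qed
  have sq_le: "(\<integral>\<^sup>+t. ennreal ((cmod (g t))\<^sup>2) \<partial>?\<mu>) \<le> ennreal ((h2norm f)\<^sup>2)"
  proof (rule nn_integral_le_if_tendsto)
    show "AE t in ?\<mu>. (\<lambda>k. ennreal ((cmod (?s (r k) t))\<^sup>2)) \<longlonglongrightarrow> ennreal ((cmod (g t))\<^sup>2)"
      using r(2) by eventually_elim (intro tendsto_intros)
    show "eventually (\<lambda>k. (\<integral>\<^sup>+t. ennreal ((cmod (?s (r k) t))\<^sup>2) \<partial>?\<mu>) \<le> ennreal ((h2norm f)\<^sup>2))
        sequentially"
      by (intro always_eventually allI nn_integral_taylor_poly_sq_le f)
  qed simp
  then have sq_int: "integrable ?\<mu> (\<lambda>t. (cmod (g t))\<^sup>2)"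
    using g(1) by (intro integrableI_bounded) (auto intro: le_less_trans)
  have "ennreal (\<integral>t. (cmod (g t))\<^sup>2 \<partial>?\<mu>) \<le> ennreal ((h2norm f)\<^sup>2)"
    using sq_le nn_integral_eq_integral[OF sq_int] by simp
  then show thesis
    using g_arc Poisson sq_int
    by (intro that[of g]) (simp_all add: integrable_harmonic_measure_iff ennreal_le_iff)
qed

lemma radial_limit_eqI:
  assumes "((\<lambda>r::real. f (of_real r * cis t)) \<longlongrightarrow> L) (at_left 1)"
  shows "radial_limit f t = L"
  unfolding radial_limit_def using assms by (intro tendsto_Lim) auto

lemma tendsto_radial_limit:
  assumes "has_radial_limit f t"
  shows "((\<lambda>r::real. f (of_real r * cis t)) \<longlongrightarrow> radial_limit f t) (at_left 1)"
  using assms radial_limit_eqI unfolding has_radial_limit_def by metis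

lemma radial_limit_Poisson_integral:
  fixes g :: "real \<Rightarrow> complex"
  assumes g: "integrable arc_length g" "\<And>z. cmod z < 1 \<Longrightarrow> (\<integral>t. g t \<partial>harmonic_measure z) = f z"
  shows "AE t in arc_length. has_radial_limit f t"
    and "AE t in arc_length. g t = radial_limit f t"
    and "radial_limit f \<in> borel_measurable arc_length"
proof -
  have lim: "AE t in arc_length. ((\<lambda>r::real. f (of_real r * cis t)) \<longlongrightarrow> g t) (at_left 1)"
    using Fatou_Poisson_integral[OF g(1)]
  proof eventually_elim
    case (elim t)
    then show ?case
      by (rule Lim_transform_eventually)
        (use eventually_at_left_1 in eventually_elim, simp add: g(2) norm_mult)
  qed
  then show "AE t in arc_length. has_radial_limit f t"
    by eventually_elim (auto simp: has_radial_limit_def)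
  show AE_eq: "AE t in arc_length. g t = radial_limit f t"
    using lim by eventually_elim (simp add: radial_limit_eqI)
  show "radial_limit f \<in> borel_measurable arc_length"
    using borel_measurable_integrable[OF g(1)]
    by (rule borel_measurable_lebesgue_on_AE[OF _ _ AE_eq]) simp
qed

lemma hardy2_radial_limit:
  assumes f: "hardy2 f"
  shows hardy2_AE_has_radial_limit: "AE t in arc_length. has_radial_limit f t"
    and hardy2_integrable_radial_limit: "integrable arc_length (radial_limit f)"
    and hardy2_Poisson_formula: "cmod z < 1 \<Longrightarrow> (\<integral>t. radial_limit f t \<partial>harmonic_measure z) = f z"
    and hardy2_integrable_radial_limit_sq: "integrable arc_length (\<lambda>t. (cmod (radial_limit f t))\<^sup>2)"
    and hardy2_integral_radial_limit_sq_le: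
      "(\<integral>t. (cmod (radial_limit f t))\<^sup>2 \<partial>harmonic_measure 0) \<le> (h2norm f)\<^sup>2"
proof -
  obtain g where g: "integrable arc_length g"
    "\<And>z. cmod z < 1 \<Longrightarrow> (\<integral>t. g t \<partial>harmonic_measure z) = f z"
    "integrable arc_length (\<lambda>t. (cmod (g t))\<^sup>2)"
    "(\<integral>t. (cmod (g t))\<^sup>2 \<partial>harmonic_measure 0) \<le> (h2norm f)\<^sup>2"
    using hardy2_boundary_function[OF f] by blast
  have [measurable]: "g \<in> borel_measurable arc_length" using g(1) by simp
  show "AE t in arc_length. has_radial_limit f t"
    using g(1,2) by (rule radial_limit_Poisson_integral)
  have AE_eq: "AE t in arc_length. g t = radial_limit f t"
    using g(1,2) by (rule radial_limit_Poisson_integral)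
  have [measurable]: "radial_limit f \<in> borel_measurable arc_length"
    using g(1,2) by (rule radial_limit_Poisson_integral)
  show "integrable arc_length (radial_limit f)"
    by (rule integrable_cong_AE_imp[OF g(1) _ AE_eq]) simp
  have AE_sq_eq: "AE t in arc_length. (cmod (g t))\<^sup>2 = (cmod (radial_limit f t))\<^sup>2"
    using AE_eq by eventually_elim simp
  show "integrable arc_length (\<lambda>t. (cmod (radial_limit f t))\<^sup>2)"
    by (rule integrable_cong_AE_imp[OF g(3) _ AE_sq_eq]) simp
  show "(\<integral>t. radial_limit f t \<partial>harmonic_measure z) = f z" if z: "cmod z < 1"
  proof -
    have "AE t in harmonic_measure z. radial_limit f t = g t"
      using AE_eq by (simp add: AE_harmonic_measure_iff z eq_commute)
    then have "(\<integral>t. radial_limit f t \<partial>harmonic_measure z) = (\<integral>t. g t \<partial>harmonic_measure z)"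
      by (intro integral_cong_AE) simp_all
    also note g(2)[OF z]
    finally show ?thesis .
  qed
  have "AE t in harmonic_measure 0. (cmod (radial_limit f t))\<^sup>2 = (cmod (g t))\<^sup>2"
    using AE_sq_eq by (simp add: AE_harmonic_measure_iff eq_commute)
  from integral_cong_AE[OF _ _ this]
  have "(\<integral>t. (cmod (radial_limit f t))\<^sup>2 \<partial>harmonic_measure 0)
      = (\<integral>t. (cmod (g t))\<^sup>2 \<partial>harmonic_measure 0)"
    by simp
  also note g(4)
  finally show "(\<integral>t. (cmod (radial_limit f t))\<^sup>2 \<partial>harmonic_measure 0) \<le> (h2norm f)\<^sup>2" .
qed

lemma radial_limit_mult:
  assumes "has_radial_limit f t" "has_radial_limit g t"
  shows "radial_limit (\<lambda>z. f z * g z) t = radial_limit f t * radial_limit g t"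
  by (intro radial_limit_eqI tendsto_mult tendsto_radial_limit assms)

lemma radial_limit_power:
  assumes "has_radial_limit f t"
  shows "has_radial_limit (\<lambda>z. f z ^ n) t" "radial_limit (\<lambda>z. f z ^ n) t = radial_limit f t ^ n"
proof -
  have lim: "((\<lambda>r::real. f (of_real r * cis t) ^ n) \<longlongrightarrow> radial_limit f t ^ n) (at_left 1)"
    by (intro tendsto_power tendsto_radial_limit assms)
  then show "has_radial_limit (\<lambda>z. f z ^ n) t"
    by (auto simp: has_radial_limit_def)
  show "radial_limit (\<lambda>z. f z ^ n) t = radial_limit f t ^ n"
    by (rule radial_limit_eqI[OF lim])
qed

lemma norm_radial_limit_le:
  assumes "has_radial_limit f t" and B: "\<And>z. cmod z < 1 \<Longrightarrow> cmod (f z) \<le> B"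
  shows "cmod (radial_limit f t) \<le> B"
proof (rule tendsto_upperbound[OF tendsto_norm[OF tendsto_radial_limit[OF assms(1)]]])
  from eventually_at_left_1
  show "eventually (\<lambda>r. cmod (f (of_real r * cis t)) \<le> B) (at_left 1)"
    by eventually_elim (rule B, simp add: norm_mult)
qed simp

lemma borel_measurable_radial_limit:
  assumes "hardy2 f"
  shows "radial_limit f \<in> borel_measurable arc_length"
  using hardy2_integrable_radial_limit[OF assms] by (rule borel_measurable_integrable)

lemma norm_sq_le_integral_radial_limit_sq:
  assumes f: "hardy2 f" and z: "cmod z < 1"
  shows "(cmod (f z))\<^sup>2 \<le> (\<integral>t. (cmod (radial_limit f t))\<^sup>2 \<partial>harmonic_measure z)"
proof -
  interpret prob_space "harmonic_measure z" by (rule prob_space_harmonic_measure[OF z])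
  have "radial_limit f \<in> borel_measurable (harmonic_measure z)"
    using borel_measurable_radial_limit[OF f] by simp
  moreover have "integrable (harmonic_measure z) (\<lambda>t. (cmod (radial_limit f t))\<^sup>2)"
    by (rule integrable_harmonic_measure[OF z hardy2_integrable_radial_limit_sq[OF f]])
  ultimately show ?thesis
    using norm_expectation_power2_le[of "radial_limit f"]
    by (simp only: hardy2_Poisson_formula[OF f z])
qed

lemma integral_radial_limit_sq_le_h2norm:
  assumes f: "hardy2 f" and z: "cmod z < 1"
  shows "(\<integral>t. (cmod (radial_limit f t))\<^sup>2 \<partial>harmonic_measure z)
    \<le> (1 + cmod z) / (1 - cmod z) * (h2norm f)\<^sup>2"
proof -
  let ?I = "\<lambda>z. \<integral>t. (cmod (radial_limit f t))\<^sup>2 \<partial>harmonic_measure z"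
  have "?I z \<le> (1 + cmod z) / (1 - cmod z) * ?I 0"
    by (rule integral_harmonic_measure_le[OF z hardy2_integrable_radial_limit_sq[OF f]]) simp
  also have "\<dots> \<le> (1 + cmod z) / (1 - cmod z) * (h2norm f)\<^sup>2"
    using z by (intro mult_left_mono hardy2_integral_radial_limit_sq_le f) simp
  finally show ?thesis .
qed

lemma norm_le_h2norm:
  assumes f: "hardy2 f" and z: "cmod z < 1"
  shows "(1 - cmod z) * (cmod (f z))\<^sup>2 \<le> 2 * (h2norm f)\<^sup>2"
proof -
  have "(cmod (f z))\<^sup>2 \<le> (1 + cmod z) * (h2norm f)\<^sup>2 / (1 - cmod z)"
    using norm_sq_le_integral_radial_limit_sq[OF assms] integral_radial_limit_sq_le_h2norm[OF assms]
    by simp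
  then have "(1 - cmod z) * (cmod (f z))\<^sup>2 \<le> (1 + cmod z) * (h2norm f)\<^sup>2"
    using z by (simp add: pos_le_divide_eq mult.commute)
  also have "\<dots> \<le> 2 * (h2norm f)\<^sup>2"
    using z by (intro mult_right_mono) auto
  finally show ?thesis .
qed

section \<open>Integral means and multipliers of the Hardy space\<close>

definition mean_sq :: "(complex \<Rightarrow> complex) \<Rightarrow> real \<Rightarrow> real" where
  "mean_sq f r = (\<integral>t. (cmod (f (of_real r * cis t)))\<^sup>2 \<partial>harmonic_measure 0)"

lemma integrable_mean_sq:
  assumes "f holomorphic_on ball 0 R" "0 \<le> r" "r < R"
  shows "integrable (harmonic_measure 0) (\<lambda>t. (cmod (f (of_real r * cis t)))\<^sup>2)"
  using assms
  by (intro integrable_harmonic_measure_continuous continuous_intros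
      continuous_on_circle[OF holomorphic_on_imp_continuous_on]) auto

lemma summable_norm_taylor_coeff:
  assumes f: "f holomorphic_on ball 0 R" and r: "0 \<le> r" "r < R"
  shows "summable (\<lambda>n. cmod (taylor_coeff f n) * r ^ n)"
proof -
  obtain s where s: "r < s" "s < R" using r dense by blast
  have "summable (\<lambda>n. taylor_coeff f n * of_real s ^ n)"
    using taylor_coeff_sums[OF f, of "of_real s"] s r by (auto simp: sums_iff)
  then have "summable (\<lambda>n. norm (taylor_coeff f n * of_real r ^ n))"
    by (rule powser_insidea) (use s r in auto)
  then show ?thesis
    using r by (simp add: norm_mult norm_power)
qed

lemma norm_taylor_poly_le:
  assumes f: "f holomorphic_on ball 0 R" and z: "cmod z < R"
  shows "cmod (taylor_poly f N z) \<le> (\<Sum>n. cmod (taylor_coeff f n) * cmod z ^ n)"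
proof -
  have "cmod (taylor_poly f N z) \<le> (\<Sum>n<N. cmod (taylor_coeff f n) * cmod z ^ n)"
    unfolding taylor_poly_def by (rule order.trans[OF norm_sum]) (simp add: norm_mult norm_power)
  also have "\<dots> \<le> (\<Sum>n. cmod (taylor_coeff f n) * cmod z ^ n)"
    using z by (intro sum_le_suminf summable_norm_taylor_coeff[OF f]) auto
  finally show ?thesis .
qed

lemma Parseval_mean_sq:
  assumes f: "f holomorphic_on ball 0 R" and r: "0 \<le> r" "r < R"
  shows "(\<lambda>n. (cmod (taylor_coeff f n))\<^sup>2 * r ^ (2*n)) sums mean_sq f r"
proof -
  interpret prob_space "harmonic_measure 0" by (rule prob_space_harmonic_measure) simp
  define B where "B = (\<Sum>n. cmod (taylor_coeff f n) * r ^ n)"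
  have norm_less: "cmod (of_real r * cis t) < R" for t
    using r by (simp add: norm_mult)
  have partial_sum: "mean_sq (taylor_poly f N) r = (\<Sum>n<N. (cmod (taylor_coeff f n))\<^sup>2 * r ^ (2*n))"
    for N
  proof -
    have "taylor_poly f N (of_real r * cis t)
        = (\<Sum>n<N. (taylor_coeff f n * of_real r ^ n) * cis t ^ n)" for t
      by (simp add: taylor_poly_def power_mult_distrib mult.assoc)
    then show ?thesis
      using r unfolding mean_sq_def
      by (simp only: Parseval_polynomial)
        (simp add: norm_mult norm_power power_mult_distrib power_even_eq)
  qed
  have "(\<lambda>N. mean_sq (taylor_poly f N) r) \<longlonglongrightarrow> mean_sq f r"
    unfolding mean_sq_def
  proof (rule integral_dominated_convergence)
    show "(\<lambda>t. (cmod (f (of_real r * cis t)))\<^sup>2) \<in> borel_measurable (harmonic_measure 0)"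
      using integrable_mean_sq[OF f r] by (rule borel_measurable_integrable)
    show "(\<lambda>t. (cmod (taylor_poly f N (of_real r * cis t)))\<^sup>2)
        \<in> borel_measurable (harmonic_measure 0)" for N
      using integrable_mean_sq[OF holomorphic_on_taylor_poly r]
      by (rule borel_measurable_integrable)
    show "integrable (harmonic_measure 0) (\<lambda>t. B\<^sup>2)" by simp
    show "AE t in harmonic_measure 0. (\<lambda>N. (cmod (taylor_poly f N (of_real r * cis t)))\<^sup>2)
         \<longlonglongrightarrow> (cmod (f (of_real r * cis t)))\<^sup>2"
      by (intro AE_I2 tendsto_intros taylor_poly_tendsto[OF f] norm_less)
    show "AE t in harmonic_measure 0. norm ((cmod (taylor_poly f N (of_real r * cis t)))\<^sup>2) \<le> B\<^sup>2"
      for N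
      using norm_taylor_poly_le[OF f norm_less] r
      by (intro AE_I2) (simp add: B_def norm_mult power_mono)
  qed
  then show ?thesis
    by (simp only: partial_sum sums_def)
qed

lemma mean_sq_tendsto_h2norm:
  assumes f: "hardy2 f"
  shows "((\<lambda>r. mean_sq f r) \<longlongrightarrow> (h2norm f)\<^sup>2) (at_left 1)"
proof -
  let ?a = "\<lambda>n. (cmod (taylor_coeff f n))\<^sup>2"
  have "((\<lambda>r. \<Sum>n. ?a n * r ^ (2*n)) \<longlongrightarrow> (\<Sum>n. ?a n * 1 ^ (2*n))) (at_left 1)"
  proof (rule tannerys_theorem[THEN conjunct2, THEN conjunct2])
    show "((\<lambda>r. ?a n * r ^ (2*n)) \<longlongrightarrow> ?a n * 1 ^ (2*n)) (at_left 1)" for n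
      by (intro tendsto_intros)
    show "summable ?a" using f by (simp add: hardy2_def)
    show "eventually (\<lambda>(n, r). norm (?a n * r ^ (2*n)) \<le> ?a n) (at_top \<times>\<^sub>F at_left 1)"
      unfolding case_prod_unfold eventually_prod_filter
      using eventually_at_left_1 by (intro exI[of _ "\<lambda>_. True"] exI[of _ "\<lambda>r. 0 < r \<and> r < 1"])
        (auto intro!: mult_right_le_one_le power_le_one)
  qed simp
  moreover have "(\<Sum>n. ?a n * 1 ^ (2*n)) = (h2norm f)\<^sup>2"
    using h2norm_sums[OF f] by (simp add: sums_iff)
  moreover have "eventually (\<lambda>r. (\<Sum>n. ?a n * r ^ (2*n)) = mean_sq f r) (at_left 1)"
    using eventually_at_left_1
    by eventually_elim (use f Parseval_mean_sq[of f 1] in \<open>simp add: hardy2_def sums_iff\<close>)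
  ultimately show ?thesis
    by (auto intro: Lim_transform_eventually)
qed

lemma mean_sq_le_h2norm:
  assumes f: "hardy2 f" and r: "0 \<le> r" "r < 1"
  shows "mean_sq f r \<le> (h2norm f)\<^sup>2"
proof (rule sums_le[OF _ Parseval_mean_sq h2norm_sums[OF f]])
  show "f holomorphic_on ball 0 1" using f by (simp add: hardy2_def)
  show "(cmod (taylor_coeff f n))\<^sup>2 * r ^ (2*n) \<le> (cmod (taylor_coeff f n))\<^sup>2" for n
    using r by (intro mult_right_le_one_le power_le_one) auto
qed (use r in auto)

lemma hardy2_if_mean_sq_bounded:
  assumes f: "f holomorphic_on ball 0 1" and B: "\<And>r. 0 < r \<Longrightarrow> r < 1 \<Longrightarrow> mean_sq f r \<le> B"
  shows "hardy2 f"
proof -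
  let ?a = "\<lambda>n. (cmod (taylor_coeff f n))\<^sup>2"
  have "(\<Sum>n<N. ?a n) \<le> B" for N
  proof (rule tendsto_upperbound)
    have "((\<lambda>r. \<Sum>n<N. ?a n * r ^ (2*n)) \<longlongrightarrow> (\<Sum>n<N. ?a n * 1 ^ (2*n))) (at_left 1)"
      by (intro tendsto_intros)
    then show "((\<lambda>r. \<Sum>n<N. ?a n * r ^ (2*n)) \<longlongrightarrow> (\<Sum>n<N. ?a n)) (at_left 1)" by simp
    from eventually_at_left_1
    show "eventually (\<lambda>r. (\<Sum>n<N. ?a n * r ^ (2*n)) \<le> B) (at_left 1)"
    proof eventually_elim
      case (elim r)
      then have Parseval: "(\<lambda>n. ?a n * r ^ (2*n)) sums mean_sq f r"
        by (intro Parseval_mean_sq[OF f]) auto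
      show ?case
        using sum_le_suminf[OF sums_summable[OF Parseval], of "{..<N}"]
          sums_unique[OF Parseval] B[of r] elim by simp
    qed
  qed simp
  then have "summable ?a"
    by (intro summableI_nonneg_bounded) auto
  with f show ?thesis by (simp add: hardy2_def)
qed

lemma hardy2_mult_bounded:
  assumes f: "hardy2 f" and g: "g holomorphic_on ball 0 1" "\<And>z. cmod z < 1 \<Longrightarrow> cmod (g z) \<le> B"
  shows "hardy2 (\<lambda>z. f z * g z)"
proof (rule hardy2_if_mean_sq_bounded)
  have hol_f: "f holomorphic_on ball 0 1" using f by (simp add: hardy2_def)
  then show hol: "(\<lambda>z. f z * g z) holomorphic_on ball 0 1"
    by (intro holomorphic_intros g)
  fix r :: real assume r: "0 < r" "r < 1"
  have "mean_sq (\<lambda>z. f z * g z) r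
      \<le> (\<integral>t. (cmod (f (of_real r * cis t)))\<^sup>2 * B\<^sup>2 \<partial>harmonic_measure 0)"
    unfolding mean_sq_def norm_mult power_mult_distrib
  proof (rule integral_mono)
    show "(cmod (f (of_real r * cis t)))\<^sup>2 * (cmod (g (of_real r * cis t)))\<^sup>2
        \<le> (cmod (f (of_real r * cis t)))\<^sup>2 * B\<^sup>2" for t
      using r by (intro mult_left_mono power_mono g(2)) (auto simp: norm_mult)
  qed (use r integrable_mean_sq[OF hol] integrable_mean_sq[OF hol_f] in
      \<open>auto simp: norm_mult power_mult_distrib\<close>)
  also have "\<dots> = mean_sq f r * B\<^sup>2"
    by (simp add: mean_sq_def)
  also have "\<dots> \<le> (h2norm f)\<^sup>2 * B\<^sup>2"
    using r by (intro mult_right_mono mean_sq_le_h2norm f) auto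
  finally show "mean_sq (\<lambda>z. f z * g z) r \<le> (h2norm f)\<^sup>2 * B\<^sup>2" .
qed

lemma hardy2_bounded:
  assumes f: "f holomorphic_on ball 0 1" and B: "\<And>z. cmod z < 1 \<Longrightarrow> cmod (f z) \<le> B"
  shows "hardy2 f" "h2norm f \<le> B"
proof -
  interpret prob_space "harmonic_measure 0" by (rule prob_space_harmonic_measure) simp
  have mean_sq_le: "mean_sq f r \<le> B\<^sup>2" if r: "0 < r" "r < 1" for r
    unfolding mean_sq_def
    by (rule integral_le_const)
      (use r B integrable_mean_sq[OF f] in \<open>auto intro!: AE_I2 power_mono simp: norm_mult\<close>)
  then show h2: "hardy2 f"
    by (rule hardy2_if_mean_sq_bounded[OF f])
  from eventually_at_left_1
  have "eventually (\<lambda>r. mean_sq f r \<le> B\<^sup>2) (at_left 1)"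
    by eventually_elim (use mean_sq_le in auto)
  then have "(h2norm f)\<^sup>2 \<le> B\<^sup>2"
    by (rule tendsto_upperbound[OF mean_sq_tendsto_h2norm[OF h2]]) simp
  moreover have "0 \<le> B" using B[of 0] norm_ge_zero[of "f 0"]
    by (metis norm_zero order.trans zero_less_one)
  ultimately show "h2norm f \<le> B" by (rule power2_le_imp_le)
qed

section \<open>Outer functions and Szego's inequality\<close>

lemma norm_one_minus_ge: "1 - cmod z \<le> cmod (1 - cis (- t) * z)"
  using norm_triangle_ineq2[of 1 "cis (- t) * z"] by (simp add: norm_mult)

lemma integrable_Cauchy_kernel:
  fixes u :: "real \<Rightarrow> complex"
  assumes u: "integrable arc_length u" and z: "cmod z < 1"
  shows "integrable arc_length (\<lambda>t. u t / (1 - cis (- t) * z))"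
proof (rule Bochner_Integration.integrable_bound)
  have denom_nonzero: "1 - cis (- t) * z \<noteq> 0" for t
    using norm_one_minus_ge[of z t] z by auto
  then have "continuous_on {0..2*pi} (\<lambda>t. 1 - cis (- t) * z)"
    by (intro continuous_intros)
  then have "(\<lambda>t. 1 - cis (- t) * z) \<in> borel_measurable arc_length"
    by (rule borel_measurable_arc_length_continuous)
  then show "(\<lambda>t. u t / (1 - cis (- t) * z)) \<in> borel_measurable arc_length"
    using borel_measurable_integrable[OF u] by measurable
  show "integrable arc_length (\<lambda>t. (1 / (1 - cmod z)) *\<^sub>R u t)"
    by (intro integrable_scaleR_right u)
  show "AE t in arc_length. norm (u t / (1 - cis (- t) * z)) \<le> norm ((1 / (1 - cmod z)) *\<^sub>R u t)"
  proof (rule AE_I2)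
    fix t
    have "cmod (u t) / cmod (1 - cis (- t) * z) \<le> cmod (u t) / (1 - cmod z)"
      using z norm_one_minus_ge[of z t] by (intro divide_left_mono mult_pos_pos) auto
    then show "norm (u t / (1 - cis (- t) * z)) \<le> norm ((1 / (1 - cmod z)) *\<^sub>R u t)"
      using z by (simp add: norm_divide)
  qed
qed

lemma holomorphic_on_Cauchy_transform:
  fixes u :: "real \<Rightarrow> complex"
  assumes u: "integrable arc_length u"
  shows "(\<lambda>z. \<integral>t. u t / (1 - cis (- t) * z) \<partial>harmonic_measure 0) holomorphic_on ball 0 1"
proof (rule power_series_holomorphic)
  fix z :: complex assume "z \<in> ball 0 1"
  then have z: "cmod z < 1" by simp
  let ?\<mu> = "harmonic_measure 0" and ?g = "\<lambda>n t. u t * (cis (- t) * z) ^ n"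
  have norm_g: "norm (?g n t) = cmod (u t) * cmod z ^ n" for n t
    by (simp add: norm_mult norm_power)
  have summable_power: "summable (\<lambda>n. cmod z ^ n)"
    using z by (intro summable_geometric) simp
  have int_g: "integrable ?\<mu> (?g n)" for n
  proof (rule Bochner_Integration.integrable_bound)
    show "integrable ?\<mu> u" by (intro integrable_harmonic_measure u) simp
    have "continuous_on {0..2*pi} (\<lambda>t. (cis (- t) * z) ^ n)" by (intro continuous_intros)
    then have "(\<lambda>t. (cis (- t) * z) ^ n) \<in> borel_measurable arc_length"
      by (rule borel_measurable_arc_length_continuous)
    then have "?g n \<in> borel_measurable arc_length"
      using borel_measurable_integrable[OF u] by measurable
    then show "?g n \<in> borel_measurable ?\<mu>" by simp
    show "AE t in ?\<mu>. norm (?g n t) \<le> norm (u t)"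
      unfolding norm_g using z by (intro AE_I2 mult_right_le_one_le power_le_one) auto
  qed
  have "(\<lambda>n. \<integral>t. ?g n t \<partial>?\<mu>) sums (\<integral>t. (\<Sum>n. ?g n t) \<partial>?\<mu>)"
  proof (rule sums_integral[OF int_g])
    show "AE t in ?\<mu>. summable (\<lambda>n. norm (?g n t))"
      unfolding norm_g by (intro AE_I2 summable_mult summable_power)
    show "summable (\<lambda>n. \<integral>t. norm (?g n t) \<partial>?\<mu>)"
      unfolding norm_g using z by (simp add: summable_mult)
  qed
  moreover have "(\<Sum>n. ?g n t) = u t / (1 - cis (- t) * z)" for t
    using sums_mult[OF geometric_sums[of "cis (- t) * z"], of "u t"] z
    by (simp add: sums_iff norm_mult)
  moreover have "(\<integral>t. ?g n t \<partial>?\<mu>) = (\<integral>t. u t * cis (- t) ^ n \<partial>?\<mu>) * (z - 0) ^ n" for n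
    by (simp add: power_mult_distrib flip: mult.assoc)
  ultimately show "(\<lambda>n. (\<integral>t. u t * cis (- t) ^ n \<partial>?\<mu>) * (z - 0) ^ n)
      sums (\<integral>t. u t / (1 - cis (- t) * z) \<partial>?\<mu>)"
    by simp
qed

lemma poisson_kernel_eq_Re:
  assumes "cmod z < 1"
  shows "poisson_kernel z t = Re (2 / (1 - cis (- t) * z) - 1)"
proof -
  define x where "x = cis (- t) * z"
  have x: "cmod x = cmod z" "1 - x \<noteq> 0"
    using norm_one_minus_ge[of z t] assms by (auto simp: x_def norm_mult)
  have "cmod (cis t - z) = cmod (cis t * (1 - x))"
    by (simp add: x_def right_diff_distrib cis_mult flip: mult.assoc)
  then have "poisson_kernel z t = (1 - (cmod x)\<^sup>2) / (cmod (1 - x))\<^sup>2"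
    by (simp add: poisson_kernel_def norm_mult x(1))
  also have "1 - (cmod x)\<^sup>2 = Re ((1 + x) * cnj (1 - x))"
    unfolding cmod_power2 by (simp add: power2_eq_square algebra_simps)
  also have "\<dots> / (cmod (1 - x))\<^sup>2 = Re ((1 + x) / (1 - x))"
    by (simp only: complex_div_cnj[of "1 + x"] Re_divide_of_real of_real_power[symmetric])
  also have "(1 + x) / (1 - x) = 2 / (1 - x) - 1"
    using x(2) by (simp add: field_simps)
  finally show ?thesis by (simp only: x_def)
qed

lemma integral_harmonic_measure_eq_at_0:
  fixes f :: "real \<Rightarrow> real"
  assumes z: "cmod z < 1" and f: "f \<in> borel_measurable arc_length"
  shows "(\<integral>t. f t \<partial>harmonic_measure z) = (\<integral>t. poisson_kernel z t * f t \<partial>harmonic_measure 0)"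
proof -
  have "(\<lambda>t. poisson_kernel z t * f t) \<in> borel_measurable arc_length"
    using f borel_measurable_poisson_kernel[OF z] by measurable
  then show ?thesis using assms by (simp add: integral_harmonic_measure)
qed

lemma Herglotz_transform:
  fixes u :: "real \<Rightarrow> real"
  assumes u: "integrable arc_length u"
  obtains H where "H holomorphic_on ball 0 1"
    "\<And>z. cmod z < 1 \<Longrightarrow> Re (H z) = (\<integral>t. u t \<partial>harmonic_measure z)"
proof
  let ?\<mu> = "harmonic_measure 0" and ?u = "\<lambda>t. complex_of_real (u t)"
  define H where "H z = 2 * (\<integral>t. ?u t / (1 - cis (- t) * z) \<partial>?\<mu>) - (\<integral>t. ?u t \<partial>?\<mu>)" for z
  have int_u: "integrable arc_length ?u" using u by simp
  show "H holomorphic_on ball 0 1"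
    unfolding H_def by (intro holomorphic_intros holomorphic_on_Cauchy_transform int_u)
  fix z :: complex assume z: "cmod z < 1"
  have int: "integrable ?\<mu> ?u" "integrable ?\<mu> (\<lambda>t. ?u t / (1 - cis (- t) * z))"
    by (intro integrable_harmonic_measure int_u integrable_Cauchy_kernel z; simp)+
  have "H z = (\<integral>t. 2 * (?u t / (1 - cis (- t) * z)) - ?u t \<partial>?\<mu>)"
    unfolding H_def
    by (subst Bochner_Integration.integral_diff[OF integrable_mult_right[OF int(2)] int(1)])
      (simp only: integral_mult_right_zero)
  also have "Re \<dots> = (\<integral>t. Re (2 * (?u t / (1 - cis (- t) * z)) - ?u t) \<partial>?\<mu>)"
    using int
    by (intro integral_Re[symmetric] Bochner_Integration.integrable_diff integrable_mult_right)
  also have "\<dots> = (\<integral>t. poisson_kernel z t * u t \<partial>?\<mu>)"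
  proof (rule Bochner_Integration.integral_cong[OF refl])
    fix t
    have "2 * (?u t / (1 - cis (- t) * z)) - ?u t = of_real (u t) * (2 / (1 - cis (- t) * z) - 1)"
      by (simp add: algebra_simps)
    then show "Re (2 * (?u t / (1 - cis (- t) * z)) - ?u t) = poisson_kernel z t * u t"
      unfolding poisson_kernel_eq_Re[OF z] by simp
  qed
  also have "\<dots> = (\<integral>t. u t \<partial>harmonic_measure z)"
    using integral_harmonic_measure_eq_at_0[OF z] u by simp
  finally show "Re (H z) = (\<integral>t. u t \<partial>harmonic_measure z)" .
qed

lemma outer_function:
  fixes u :: "real \<Rightarrow> real"
  assumes u: "integrable arc_length u"
  obtains F where "F holomorphic_on ball 0 1"
    "\<And>z. cmod z < 1 \<Longrightarrow> (cmod (F z))\<^sup>2 = exp (\<integral>t. u t \<partial>harmonic_measure z)"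
proof -
  obtain H where H: "H holomorphic_on ball 0 1"
    "\<And>z. cmod z < 1 \<Longrightarrow> Re (H z) = (\<integral>t. u t \<partial>harmonic_measure z)"
    using Herglotz_transform[OF u] by blast
  show thesis
  proof
    show "(\<lambda>z. exp (H z / 2)) holomorphic_on ball 0 1"
      by (intro holomorphic_intros H) auto
    show "(cmod (exp (H z / 2)))\<^sup>2 = exp (\<integral>t. u t \<partial>harmonic_measure z)" if "cmod z < 1" for z
      by (simp add: power2_eq_square H(2)[OF that] flip: exp_add)
  qed
qed

lemma bounded_outer_function:
  fixes u :: "real \<Rightarrow> real"
  assumes u: "u \<in> borel_measurable arc_length" "AE t in arc_length. \<bar>u t\<bar> \<le> B"
  obtains F where "F holomorphic_on ball 0 1" "\<And>z. cmod z < 1 \<Longrightarrow> cmod (F z) \<le> exp (B / 2)"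
    "\<And>z. cmod z < 1 \<Longrightarrow> (cmod (F z))\<^sup>2 = exp (\<integral>t. u t \<partial>harmonic_measure z)"
    "AE t in arc_length. (cmod (radial_limit F t))\<^sup>2 = exp (u t)"
proof -
  have int_u: "integrable arc_length u"
    using u by (intro integrable_arc_length_AE_bounded[of u B]) simp_all
  obtain F where hol_F: "F holomorphic_on ball 0 1"
    and norm_F: "\<And>z. cmod z < 1 \<Longrightarrow> (cmod (F z))\<^sup>2 = exp (\<integral>t. u t \<partial>harmonic_measure z)"
    using outer_function[OF int_u] by blast
  have F_bound: "cmod (F z) \<le> exp (B / 2)" if z: "cmod z < 1" for z
  proof (rule power2_le_imp_le)
    interpret prob_space "harmonic_measure z" by (rule prob_space_harmonic_measure[OF z])
    have "AE t in harmonic_measure z. u t \<le> B"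
      unfolding AE_harmonic_measure_iff[OF z] using u(2) by eventually_elim simp
    then have "(\<integral>t. u t \<partial>harmonic_measure z) \<le> B"
      by (intro integral_le_const integrable_harmonic_measure z int_u)
    moreover have "(exp (B / 2))\<^sup>2 = exp B"
      by (simp add: power2_eq_square flip: exp_add)
    ultimately show "(cmod (F z))\<^sup>2 \<le> (exp (B / 2))\<^sup>2"
      by (simp only: norm_F[OF z] exp_le_cancel_iff)
  qed simp
  have "hardy2 F" by (rule hardy2_bounded(1)[OF hol_F F_bound])
  have "AE t in arc_length. (cmod (radial_limit F t))\<^sup>2 = exp (u t)"
    using hardy2_AE_has_radial_limit[OF \<open>hardy2 F\<close>] Fatou_Poisson_integral_real[OF int_u]
  proof eventually_elim
    case (elim t)
    have "((\<lambda>r. (cmod (F (of_real r * cis t)))\<^sup>2) \<longlongrightarrow> exp (u t)) (at_left 1)"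
      using tendsto_exp[OF elim(2)]
      by (rule Lim_transform_eventually)
        (use eventually_at_left_1 in eventually_elim, simp add: norm_F norm_mult)
    moreover have "((\<lambda>r. (cmod (F (of_real r * cis t)))\<^sup>2) \<longlongrightarrow> (cmod (radial_limit F t))\<^sup>2) (at_left 1)"
      by (intro tendsto_intros tendsto_radial_limit elim)
    ultimately have "exp (u t) = (cmod (radial_limit F t))\<^sup>2"
      by (rule tendsto_unique[OF trivial_limit_at_left_real])
    then show ?case ..
  qed
  with hol_F F_bound norm_F show thesis by (rule that)
qed

text \<open>Multiplying \<open>h\<close>
  by the outer function with modulus \<open>exp (u / 2)\<close> on the circle reduces the claim to
  the case \<open>u = 0\<close>.\<close>
theorem Szego_inequality:
  fixes u :: "real \<Rightarrow> real"
  assumes h: "hardy2 h" and u: "u \<in> borel_measurable arc_length" "AE t in arc_length. \<bar>u t\<bar> \<le> B"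
    and z: "cmod z < 1"
  shows "(cmod (h z))\<^sup>2 * exp (\<integral>t. u t \<partial>harmonic_measure z)
    \<le> (\<integral>t. (cmod (radial_limit h t))\<^sup>2 * exp (u t) \<partial>harmonic_measure z)"
proof -
  obtain F where hol_F: "F holomorphic_on ball 0 1" and F_bound: "\<And>z. cmod z < 1 \<Longrightarrow> cmod (F z)
      \<le> exp (B / 2)"
    and norm_F: "\<And>z. cmod z < 1 \<Longrightarrow> (cmod (F z))\<^sup>2 = exp (\<integral>t. u t \<partial>harmonic_measure z)"
    and boundary_F: "AE t in arc_length. (cmod (radial_limit F t))\<^sup>2 = exp (u t)"
    using bounded_outer_function[OF u] by blast
  let ?hF = "\<lambda>\<zeta>. h \<zeta> * F \<zeta>"
  have h2_F: "hardy2 F" by (rule hardy2_bounded(1)[OF hol_F F_bound])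
  have h2_hF: "hardy2 ?hF" by (rule hardy2_mult_bounded[OF h hol_F F_bound])
  have "AE t in arc_length. (cmod (radial_limit ?hF t))\<^sup>2 = (cmod (radial_limit h t))\<^sup>2 * exp (u t)"
    using hardy2_AE_has_radial_limit[OF h] hardy2_AE_has_radial_limit[OF h2_F] boundary_F
    by eventually_elim (simp add: radial_limit_mult norm_mult power_mult_distrib)
  then have boundary_hF: "AE t in harmonic_measure z.
      (cmod (radial_limit ?hF t))\<^sup>2 = (cmod (radial_limit h t))\<^sup>2 * exp (u t)"
    unfolding AE_harmonic_measure_iff[OF z] .
  have [measurable]: "radial_limit h \<in> borel_measurable arc_length" "radial_limit ?hF
      \<in> borel_measurable arc_length"
    by (intro borel_measurable_radial_limit h h2_hF)+
  have "(cmod (h z))\<^sup>2 * exp (\<integral>t. u t \<partial>harmonic_measure z) = (cmod (?hF z))\<^sup>2"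
    by (simp add: norm_mult power_mult_distrib norm_F[OF z])
  also have "\<dots> \<le> (\<integral>t. (cmod (radial_limit ?hF t))\<^sup>2 \<partial>harmonic_measure z)"
    by (rule norm_sq_le_integral_radial_limit_sq[OF h2_hF z])
  also have "\<dots> = (\<integral>t. (cmod (radial_limit h t))\<^sup>2 * exp (u t) \<partial>harmonic_measure z)"
    using u(1) by (intro integral_cong_AE boundary_hF) simp_all
  finally show ?thesis .
qed

section \<open>Necessity of the integral condition\<close>

definition truncated_log :: "nat \<Rightarrow> real \<Rightarrow> real" where
  "truncated_log N x = ln ((1 + x) * (\<Sum>n\<le>N. x ^ (2*n)))"

lemma truncated_log_bounds:
  assumes "0 \<le> x" "x \<le> 1"
  shows "0 \<le> truncated_log N x" "truncated_log N x \<le> ln (2 * (real N + 1))"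
    and "exp (truncated_log N x) \<le> 2 * (\<Sum>n\<le>N. x ^ (2*n))"
proof -
  have "(\<Sum>n\<in>{0}. x ^ (2*n)) \<le> (\<Sum>n\<le>N. x ^ (2*n))"
    using assms by (intro sum_mono2) auto
  then have sum_ge_1: "1 \<le> (\<Sum>n\<le>N. x ^ (2*n))" by simp
  have "1 * 1 \<le> (1 + x) * (\<Sum>n\<le>N. x ^ (2*n))"
    using assms sum_ge_1 by (intro mult_mono) auto
  then have arg_ge_1: "1 \<le> (1 + x) * (\<Sum>n\<le>N. x ^ (2*n))" by simp
  then show "0 \<le> truncated_log N x"
    by (simp add: truncated_log_def)
  have arg_le: "(1 + x) * (\<Sum>n\<le>N. x ^ (2*n)) \<le> 2 * (\<Sum>n\<le>N. x ^ (2*n))"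
    using assms sum_ge_1 by (intro mult_right_mono) auto
  then show "exp (truncated_log N x) \<le> 2 * (\<Sum>n\<le>N. x ^ (2*n))"
    using arg_ge_1 by (simp add: truncated_log_def)
  have "(\<Sum>n\<le>N. x ^ (2*n)) \<le> (\<Sum>n\<le>N. 1)"
    using assms by (intro sum_mono power_le_one) auto
  then have "(1 + x) * (\<Sum>n\<le>N. x ^ (2*n)) \<le> 2 * (real N + 1)"
    using arg_le by simp
  then show "truncated_log N x \<le> ln (2 * (real N + 1))"
    unfolding truncated_log_def using arg_ge_1 by (intro ln_mono) auto
qed

definition log_defect :: "real \<Rightarrow> ennreal" where
  "log_defect x = (if x < 1 then ennreal (ln (1 / (1 - x))) else \<infinity>)"

lemma truncated_log_tendsto:
  assumes "0 \<le> x" "x \<le> 1"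
  shows "(\<lambda>N. ennreal (truncated_log N x)) \<longlonglongrightarrow> log_defect x"
proof (cases "x < 1")
  case True
  have pos: "0 < 1 + x" using assms by simp
  have "(\<lambda>n. x ^ (2*n)) sums (1 / (1 - x\<^sup>2))"
    using geometric_sums[of "x\<^sup>2"] assms True by (simp add: power_mult abs_square_less_1)
  then have "(\<lambda>N. (1 + x) * (\<Sum>n\<le>N. x ^ (2*n))) \<longlonglongrightarrow> (1 + x) * (1 / (1 - x\<^sup>2))"
    unfolding sums_def_le by (intro tendsto_intros)
  also have "1 - x\<^sup>2 = (1 + x) * (1 - x)"
    by (simp add: power2_eq_square algebra_simps)
  also have "(1 + x) * (1 / ((1 + x) * (1 - x))) = 1 / (1 - x)"
    using pos by simp
  finally have "(\<lambda>N. truncated_log N x) \<longlonglongrightarrow> ln (1 / (1 - x))"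
    unfolding truncated_log_def using True by (intro tendsto_intros) auto
  then show ?thesis using True by (simp add: log_defect_def tendsto_ennrealI)
next
  case False
  then have "x = 1" using assms by simp
  have "filterlim (\<lambda>N. ln (2 * (real N + 1))) at_top sequentially"
    by real_asymp
  then show ?thesis
    using \<open>x = 1\<close>
    by (simp add: log_defect_def truncated_log_def ennreal_tendsto_top_eq_at_top add.commute)
qed

lemma circle_log_integral_finite_iff:
  "circle_log_integral \<phi> < \<infinity> \<longleftrightarrow> (\<integral>\<^sup>+ t. log_integrand \<phi> t \<partial>arc_length) < \<infinity>"
proof -
  have "(\<integral>\<^sup>+ t. log_integrand \<phi> t \<partial>arc_length) = (\<integral>\<^sup>+ t\<in>{0..2*pi}. log_integrand \<phi> t \<partial>lebesgue)"
    by (simp add: nn_integral_restrict_space)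
  also have "\<dots> = (\<integral>\<^sup>+ t\<in>{0..2*pi}. log_integrand \<phi> t \<partial>lborel)"
    by (rule nn_integral_completion)
  finally show ?thesis
    unfolding circle_log_integral_def less_top[symmetric] infinity_ennreal_def
    by (simp add: ennreal_divide_eq_top_iff)
qed

lemma nn_integral_arc_length_finite:
  assumes z: "cmod z < 1" and f: "f \<in> borel_measurable arc_length"
    and fin: "(\<integral>\<^sup>+ t. f t \<partial>harmonic_measure z) < \<infinity>"
  shows "(\<integral>\<^sup>+ t. f t \<partial>arc_length) < \<infinity>"
proof -
  define c where "c = (1 - cmod z) / (1 + cmod z) / (2*pi)"
  have c: "0 < c" using z unfolding c_def by (intro divide_pos_pos) (auto intro: add_pos_nonneg)
  have "ennreal c * (\<integral>\<^sup>+ t. f t \<partial>arc_length) = (\<integral>\<^sup>+ t. ennreal c * f t \<partial>arc_length)"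
    using f by (rule nn_integral_cmult[symmetric])
  also have "\<dots> \<le> (\<integral>\<^sup>+ t. ennreal (poisson_kernel z t / (2*pi)) * f t \<partial>arc_length)"
    unfolding c_def using poisson_kernel_bounds(1)[OF z]
    by (intro nn_integral_mono mult_right_mono ennreal_leI divide_right_mono) auto
  also have "\<dots> = (\<integral>\<^sup>+ t. f t \<partial>harmonic_measure z)"
    unfolding harmonic_measure_def using f borel_measurable_poisson_kernel[OF z]
    by (intro nn_integral_density[symmetric]) auto
  finally have "ennreal c * (\<integral>\<^sup>+ t. f t \<partial>arc_length) < \<infinity>"
    using fin by (rule le_less_trans)
  then show ?thesis
    using c by (auto simp: ennreal_mult_less_top)
qed

lemma AE_log_integrand:
  assumes "hardy2 f"
  shows "AE t in arc_length. log_integrand f t = log_defect (cmod (radial_limit f t))"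
  using hardy2_AE_has_radial_limit[OF assms]
  by eventually_elim (simp add: log_integrand_def log_defect_def)

lemma borel_measurable_log_integrand:
  assumes "hardy2 f"
  shows "log_integrand f \<in> borel_measurable arc_length"
proof (rule borel_measurable_lebesgue_on_AE)
  show "(\<lambda>t. log_defect (cmod (radial_limit f t))) \<in> borel_measurable arc_length"
    unfolding log_defect_def using borel_measurable_radial_limit[OF assms] by measurable
  show "AE t in arc_length. log_defect (cmod (radial_limit f t)) = log_integrand f t"
    using AE_log_integrand[OF assms] by eventually_elim (rule sym)
qed simp

lemma wcomp_HS_power:
  assumes "wcomp_HS w \<phi>"
  shows "hardy2 (\<lambda>z. w z * \<phi> z ^ n)"
proof -
  have "hardy2 (\<lambda>z. z ^ n)"
    by (rule hardy2_bounded(1)[of _ 1])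
      (auto intro!: holomorphic_intros simp: norm_power power_le_one)
  then show ?thesis
    using assms unfolding wcomp_HS_def by blast
qed

lemma AE_weighted_truncated_log_le:
  assumes \<phi>: "hardy2 \<phi>" "\<And>z. cmod z < 1 \<Longrightarrow> cmod (\<phi> z) \<le> 1" and w: "hardy2 w"
  shows "AE t in arc_length.
    (cmod (radial_limit w t))\<^sup>2 * exp (truncated_log N (cmod (radial_limit \<phi> t)))
    \<le> 2 * (\<Sum>n\<le>N. (cmod (radial_limit (\<lambda>z. w z * \<phi> z ^ n) t))\<^sup>2)"
  using hardy2_AE_has_radial_limit[OF w] hardy2_AE_has_radial_limit[OF \<phi>(1)]
proof eventually_elim
  case (elim t)
  let ?x = "cmod (radial_limit \<phi> t)"
  have "exp (truncated_log N ?x) \<le> 2 * (\<Sum>n\<le>N. ?x ^ (2*n))"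
    using elim \<phi>(2) by (intro truncated_log_bounds norm_radial_limit_le) auto
  then have "(cmod (radial_limit w t))\<^sup>2 * exp (truncated_log N ?x)
      \<le> (cmod (radial_limit w t))\<^sup>2 * (2 * (\<Sum>n\<le>N. ?x ^ (2*n)))"
    by (rule mult_left_mono) simp
  also have "\<dots> = 2 * (\<Sum>n\<le>N. (cmod (radial_limit (\<lambda>z. w z * \<phi> z ^ n) t))\<^sup>2)"
    using elim by (simp add: radial_limit_mult radial_limit_power norm_mult norm_power
        power_mult_distrib power_even_eq sum_distrib_left mult.left_commute)
  finally show ?case .
qed

lemma integral_weighted_truncated_log_le:
  assumes \<phi>: "hardy2 \<phi>" "\<And>z. cmod z < 1 \<Longrightarrow> cmod (\<phi> z) \<le> 1" and w: "hardy2 w"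
    and HS: "wcomp_HS w \<phi>" and z: "cmod z < 1"
  shows "(\<integral>t. (cmod (radial_limit w t))\<^sup>2 * exp (truncated_log N (cmod (radial_limit \<phi> t)))
      \<partial>harmonic_measure z)
    \<le> 2 * ((1 + cmod z) / (1 - cmod z)) * (\<Sum>n. (h2norm (\<lambda>z. w z * \<phi> z ^ n))\<^sup>2)"
proof -
  let ?f = "\<lambda>n z. w z * \<phi> z ^ n" and ?C = "(1 + cmod z) / (1 - cmod z)"
  have int_sq: "integrable (harmonic_measure z) (\<lambda>t. (cmod (radial_limit (?f n) t))\<^sup>2)" for n
    by (intro integrable_harmonic_measure z hardy2_integrable_radial_limit_sq wcomp_HS_power HS)
  have "(\<integral>t. (cmod (radial_limit w t))\<^sup>2 * exp (truncated_log N (cmod (radial_limit \<phi> t)))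
        \<partial>harmonic_measure z)
      \<le> (\<integral>t. 2 * (\<Sum>n\<le>N. (cmod (radial_limit (?f n) t))\<^sup>2) \<partial>harmonic_measure z)"
  proof (rule integral_mono_AE')
    show "integrable (harmonic_measure z) (\<lambda>t. 2 * (\<Sum>n\<le>N. (cmod (radial_limit (?f n) t))\<^sup>2))"
      using int_sq by simp
    show "AE t in harmonic_measure z.
        (cmod (radial_limit w t))\<^sup>2 * exp (truncated_log N (cmod (radial_limit \<phi> t)))
        \<le> 2 * (\<Sum>n\<le>N. (cmod (radial_limit (?f n) t))\<^sup>2)"
      unfolding AE_harmonic_measure_iff[OF z] by (rule AE_weighted_truncated_log_le[OF \<phi> w])
  qed (simp add: sum_nonneg)
  also have "\<dots> = 2 * (\<Sum>n\<le>N. \<integral>t. (cmod (radial_limit (?f n) t))\<^sup>2 \<partial>harmonic_measure z)"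
    using int_sq by simp
  also have "\<dots> \<le> 2 * (\<Sum>n\<le>N. ?C * (h2norm (?f n))\<^sup>2)"
    by (intro mult_left_mono sum_mono integral_radial_limit_sq_le_h2norm wcomp_HS_power HS z) simp
  also have "\<dots> = 2 * ?C * (\<Sum>n\<le>N. (h2norm (?f n))\<^sup>2)"
    by (simp only: sum_distrib_left mult.assoc)
  also have "\<dots> \<le> 2 * ?C * (\<Sum>n. (h2norm (?f n))\<^sup>2)"
    using z HS unfolding wcomp_HS_def by (intro mult_left_mono sum_le_suminf) auto
  finally show ?thesis .
qed

lemma AE_truncated_log_bounds:
  assumes \<phi>: "hardy2 \<phi>" "\<And>z. cmod z < 1 \<Longrightarrow> cmod (\<phi> z) \<le> 1"
  shows "AE t in arc_length. \<bar>truncated_log N (cmod (radial_limit \<phi> t))\<bar> \<le> ln (2 * (real N + 1))"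
  using hardy2_AE_has_radial_limit[OF \<phi>(1)]
proof eventually_elim
  case (elim t)
  then have "cmod (radial_limit \<phi> t) \<le> 1" using \<phi>(2) by (rule norm_radial_limit_le)
  then show ?case
    using truncated_log_bounds(1,2)[of "cmod (radial_limit \<phi> t)" N] by simp
qed

lemma borel_measurable_truncated_log:
  assumes "hardy2 \<phi>"
  shows "(\<lambda>t. truncated_log N (cmod (radial_limit \<phi> t))) \<in> borel_measurable arc_length"
  unfolding truncated_log_def using borel_measurable_radial_limit[OF assms] by measurable

lemma integrable_truncated_log:
  assumes \<phi>: "hardy2 \<phi>" "\<And>z. cmod z < 1 \<Longrightarrow> cmod (\<phi> z) \<le> 1"
  shows "integrable arc_length (\<lambda>t. truncated_log N (cmod (radial_limit \<phi> t)))"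
  by (rule integrable_arc_length_AE_bounded[OF borel_measurable_truncated_log])
    (use \<phi> AE_truncated_log_bounds in auto)

lemma integral_truncated_log_bounded:
  assumes \<phi>: "hardy2 \<phi>" "\<And>z. cmod z < 1 \<Longrightarrow> cmod (\<phi> z) \<le> 1" and w: "hardy2 w"
    and HS: "wcomp_HS w \<phi>" and z: "cmod z < 1" "w z \<noteq> 0"
  obtains C where "\<And>N. (\<integral>t. truncated_log N (cmod (radial_limit \<phi> t)) \<partial>harmonic_measure z) \<le> C"
proof
  let ?I = "\<lambda>N. \<integral>t. truncated_log N (cmod (radial_limit \<phi> t)) \<partial>harmonic_measure z"
  define K where "K = 2 * ((1 + cmod z) / (1 - cmod z)) * (\<Sum>n. (h2norm (\<lambda>z. w z * \<phi> z ^ n))\<^sup>2)"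
  fix N
  have "(cmod (w z))\<^sup>2 * exp (?I N) \<le> K"
    using Szego_inequality[OF w borel_measurable_truncated_log[OF \<phi>(1)]
        AE_truncated_log_bounds[OF \<phi>] z(1)]
      integral_weighted_truncated_log_le[OF \<phi> w HS z(1)]
    unfolding K_def by (rule order.trans)
  then have exp_le: "exp (?I N) \<le> K / (cmod (w z))\<^sup>2"
    using z(2) by (simp add: pos_le_divide_eq mult.commute)
  then show "?I N \<le> ln (K / (cmod (w z))\<^sup>2)"
    using less_le_trans[OF exp_gt_zero exp_le] by (simp add: ln_ge_iff)
qed

lemma circle_log_integral_finite_if_HS:
  assumes hol: "\<phi> holomorphic_on ball 0 1" and \<phi>: "\<And>z. cmod z < 1 \<Longrightarrow> cmod (\<phi> z) \<le> 1"
    and w: "hardy2 w" and HS: "wcomp_HS w \<phi>" and z: "cmod z < 1" "w z \<noteq> 0"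
  shows "circle_log_integral \<phi> < \<infinity>"
proof -
  let ?v = "\<lambda>N t. truncated_log N (cmod (radial_limit \<phi> t))"
  have h2_\<phi>: "hardy2 \<phi>" by (rule hardy2_bounded(1)[OF hol \<phi>])
  have int_v: "integrable (harmonic_measure z) (?v N)" for N
    by (intro integrable_harmonic_measure z(1) integrable_truncated_log h2_\<phi> \<phi>)
  have AE_le_1: "AE t in harmonic_measure z. cmod (radial_limit \<phi> t) \<le> 1"
    unfolding AE_harmonic_measure_iff[OF z(1)]
    using hardy2_AE_has_radial_limit[OF h2_\<phi>] by eventually_elim (rule norm_radial_limit_le[OF _ \<phi>])
  have AE_log: "AE t in harmonic_measure z. log_integrand \<phi> t = log_defect (cmod (radial_limit \<phi> t))"
    unfolding AE_harmonic_measure_iff[OF z(1)] by (rule AE_log_integrand[OF h2_\<phi>])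
  obtain C where C: "\<And>N. (\<integral>t. ?v N t \<partial>harmonic_measure z) \<le> C"
    using integral_truncated_log_bounded[OF h2_\<phi> \<phi> w HS z] by blast
  have "(\<integral>\<^sup>+t. log_integrand \<phi> t \<partial>harmonic_measure z) \<le> ennreal C"
  proof (rule nn_integral_le_if_tendsto)
    show "(\<lambda>t. ennreal (?v N t)) \<in> borel_measurable (harmonic_measure z)" for N
      by (intro measurable_compose[OF _ measurable_ennreal] borel_measurable_integrable int_v)
    show "AE t in harmonic_measure z. (\<lambda>N. ennreal (?v N t)) \<longlonglongrightarrow> log_integrand \<phi> t"
      using AE_le_1 AE_log by eventually_elim (simp only: truncated_log_tendsto norm_ge_zero)
    have "(\<integral>\<^sup>+t. ennreal (?v N t) \<partial>harmonic_measure z) \<le> ennreal C" for N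
    proof -
      have "AE t in harmonic_measure z. 0 \<le> ?v N t"
        using AE_le_1 by eventually_elim (simp add: truncated_log_bounds)
      then show ?thesis
        using C[of N] by (simp add: nn_integral_eq_integral[OF int_v] ennreal_leI)
    qed
    then show "eventually (\<lambda>N. (\<integral>\<^sup>+t. ennreal (?v N t) \<partial>harmonic_measure z) \<le> ennreal C) sequentially"
      by (rule always_eventually[OF allI])
  qed
  also have "\<dots> < \<infinity>" by simp
  finally show ?thesis
    unfolding circle_log_integral_finite_iff
    by (rule nn_integral_arc_length_finite[OF z(1) borel_measurable_log_integrand[OF h2_\<phi>]])
qed

section \<open>Sufficiency of the integral condition\<close>

lemma AE_radial_limit_less_1:
  assumes \<phi>: "hardy2 \<phi>" and fin: "circle_log_integral \<phi> < \<infinity>"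
  shows "AE t in arc_length. cmod (radial_limit \<phi> t) < 1"
proof -
  have "AE t in arc_length. log_integrand \<phi> t \<noteq> \<infinity>"
    using nn_integral_noteq_infinite[OF borel_measurable_log_integrand[OF \<phi>]] fin
    unfolding circle_log_integral_finite_iff by simp
  then show ?thesis
    by eventually_elim (simp add: log_integrand_def split: if_splits)
qed

lemma integrable_ln_one_minus_radial_limit:
  assumes \<phi>: "hardy2 \<phi>" and fin: "circle_log_integral \<phi> < \<infinity>"
  shows "integrable arc_length (\<lambda>t. ln (1 - cmod (radial_limit \<phi> t)))"
proof (rule integrableI_bounded)
  let ?u = "\<lambda>t. ln (1 - cmod (radial_limit \<phi> t))"
  show "?u \<in> borel_measurable arc_length"
    using borel_measurable_radial_limit[OF \<phi>] by measurable
  have "(\<integral>\<^sup>+ t. ennreal (norm (?u t)) \<partial>arc_length) = (\<integral>\<^sup>+ t. log_integrand \<phi> t \<partial>arc_length)"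
    using AE_radial_limit_less_1[OF assms] AE_log_integrand[OF \<phi>]
    by (intro nn_integral_cong_AE, eventually_elim) (simp add: log_defect_def ln_div)
  then show "(\<integral>\<^sup>+ t. ennreal (norm (?u t)) \<partial>arc_length) < \<infinity>"
    using fin by (simp only: circle_log_integral_finite_iff)
qed

lemma exp_integral_ln_one_minus_radial_limit_le:
  assumes \<phi>: "hardy2 \<phi>" and fin: "circle_log_integral \<phi> < \<infinity>" and z: "cmod z < 1"
  shows "exp (\<integral>t. ln (1 - cmod (radial_limit \<phi> t)) \<partial>harmonic_measure z) \<le> 1 - cmod (\<phi> z)"
proof -
  let ?u = "\<lambda>t. ln (1 - cmod (radial_limit \<phi> t))"
  interpret prob_space "harmonic_measure z" by (rule prob_space_harmonic_measure[OF z])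
  have int_u: "integrable (harmonic_measure z) ?u"
    by (intro integrable_harmonic_measure z integrable_ln_one_minus_radial_limit \<phi> fin)
  have int_norm: "integrable (harmonic_measure z) (\<lambda>t. cmod (radial_limit \<phi> t))"
    by (intro integrable_norm integrable_harmonic_measure z hardy2_integrable_radial_limit \<phi>)
  then have int_diff: "integrable (harmonic_measure z) (\<lambda>t. 1 - cmod (radial_limit \<phi> t))"
    by simp
  have exp_u: "AE t in harmonic_measure z. 1 - cmod (radial_limit \<phi> t) = exp (?u t)"
    unfolding AE_harmonic_measure_iff[OF z] using AE_radial_limit_less_1[OF \<phi> fin]
    by eventually_elim simp
  have meas_exp_u: "(\<lambda>t. exp (?u t)) \<in> borel_measurable (harmonic_measure z)"
    using borel_measurable_radial_limit[OF \<phi>] by simp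
  have "exp (\<integral>t. ?u t \<partial>harmonic_measure z) \<le> (\<integral>t. exp (?u t) \<partial>harmonic_measure z)"
    by (rule jensens_inequality[where I = UNIV])
      (use int_u integrable_cong_AE_imp[OF int_diff meas_exp_u exp_u] exp_convex in auto)
  also have "\<dots> = (\<integral>t. 1 - cmod (radial_limit \<phi> t) \<partial>harmonic_measure z)"
    by (rule integral_cong_AE[OF meas_exp_u borel_measurable_integrable[OF int_diff]])
      (use exp_u in eventually_elim, simp)
  also have "\<dots> = 1 - (\<integral>t. cmod (radial_limit \<phi> t) \<partial>harmonic_measure z)"
    using int_norm by (simp add: prob_space[simplified])
  also have "\<dots> \<le> 1 - cmod (\<phi> z)"
    using integral_norm_bound[of "harmonic_measure z" "radial_limit \<phi>"]
    by (simp add: hardy2_Poisson_formula[OF \<phi> z])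
  finally show ?thesis .
qed

lemma weight_exists:
  assumes \<phi>: "hardy2 \<phi>" and fin: "circle_log_integral \<phi> < \<infinity>"
  obtains w where "w holomorphic_on ball 0 1" "w 0 \<noteq> 0"
    "\<And>z. cmod z < 1 \<Longrightarrow> (cmod (w z))\<^sup>2 \<le> 1 - cmod (\<phi> z)"
proof -
  obtain w where w: "w holomorphic_on ball 0 1"
    "\<And>z. cmod z < 1 \<Longrightarrow> (cmod (w z))\<^sup>2
        = exp (\<integral>t. ln (1 - cmod (radial_limit \<phi> t)) \<partial>harmonic_measure z)"
    using outer_function[OF integrable_ln_one_minus_radial_limit[OF assms]] by blast
  show thesis
  proof
    show "w 0 \<noteq> 0" using w(2)[of 0] by auto
    show "(cmod (w z))\<^sup>2 \<le> 1 - cmod (\<phi> z)" if "cmod z < 1" for z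
      using exp_integral_ln_one_minus_radial_limit_le[OF assms that] w(2)[OF that] by simp
  qed (rule w(1))
qed

lemma sum_norm_sq_mult_power_le:
  fixes a b :: complex
  assumes "cmod b < 1" "(cmod a)\<^sup>2 \<le> 1 - (cmod b)\<^sup>2"
  shows "(\<Sum>n<N. (cmod (a * b ^ n))\<^sup>2) \<le> 1"
proof -
  let ?x = "(cmod b)\<^sup>2"
  have "?x < 1" using assms(1) by (simp add: abs_square_less_1)
  have "(cmod (a * b ^ n))\<^sup>2 = (cmod a)\<^sup>2 * ?x ^ n" for n
    by (simp add: norm_mult norm_power power_mult_distrib flip: power_mult) (simp add: mult.commute)
  then have "(\<Sum>n<N. (cmod (a * b ^ n))\<^sup>2) = (cmod a)\<^sup>2 * (\<Sum>n<N. ?x ^ n)"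
    by (simp add: sum_distrib_left)
  also have "\<dots> \<le> (1 - ?x) * (\<Sum>n<N. ?x ^ n)"
    by (intro mult_right_mono assms(2) sum_nonneg) auto
  also have "\<dots> = 1 - ?x ^ N"
    using \<open>?x < 1\<close> by (simp add: sum_gp_strict)
  also have "\<dots> \<le> 1" by simp
  finally show ?thesis .
qed

lemma summable_h2norm_mult_power:
  assumes hol: "w holomorphic_on ball 0 1" "\<phi> holomorphic_on ball 0 1"
    and \<phi>: "\<And>z. cmod z < 1 \<Longrightarrow> cmod (\<phi> z) < 1"
    and w: "\<And>z. cmod z < 1 \<Longrightarrow> (cmod (w z))\<^sup>2 \<le> 1 - (cmod (\<phi> z))\<^sup>2"
  shows "summable (\<lambda>n. (h2norm (\<lambda>z. w z * \<phi> z ^ n))\<^sup>2)"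
proof (rule summableI_nonneg_bounded)
  interpret prob_space "harmonic_measure 0" by (rule prob_space_harmonic_measure) simp
  let ?f = "\<lambda>n z. w z * \<phi> z ^ n"
  have hol_f: "?f n holomorphic_on ball 0 1" for n
    by (intro holomorphic_intros hol)
  have h2_f: "hardy2 (?f n)" for n
  proof (rule hardy2_bounded(1)[OF hol_f])
    fix z :: complex assume z: "cmod z < 1"
    have "(\<Sum>k\<in>{n}. (cmod (?f k z))\<^sup>2) \<le> (\<Sum>k<Suc n. (cmod (?f k z))\<^sup>2)"
      by (rule sum_mono2) auto
    also have "\<dots> \<le> 1"
      by (intro sum_norm_sq_mult_power_le \<phi> w z)
    finally show "cmod (?f n z) \<le> 1" by (simp add: abs_square_le_1)
  qed
  show "(\<Sum>n<N. (h2norm (?f n))\<^sup>2) \<le> 1" for N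
  proof (rule tendsto_upperbound)
    show "((\<lambda>r. \<Sum>n<N. mean_sq (?f n) r) \<longlongrightarrow> (\<Sum>n<N. (h2norm (?f n))\<^sup>2)) (at_left 1)"
      by (intro tendsto_sum mean_sq_tendsto_h2norm h2_f)
    from eventually_at_left_1 show "eventually (\<lambda>r. (\<Sum>n<N. mean_sq (?f n) r) \<le> 1) (at_left 1)"
    proof eventually_elim
      case (elim r)
      have int_f: "integrable (harmonic_measure 0) (\<lambda>t. (cmod (?f n (of_real r * cis t)))\<^sup>2)" for n
        using elim by (intro integrable_mean_sq[OF hol_f]) auto
      have "(\<Sum>n<N. mean_sq (?f n) r)
          = (\<integral>t. (\<Sum>n<N. (cmod (?f n (of_real r * cis t)))\<^sup>2) \<partial>harmonic_measure 0)"
        unfolding mean_sq_def using int_f by (intro Bochner_Integration.integral_sum[symmetric])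
      also have "\<dots> \<le> 1"
        using int_f elim
        by (intro integral_le_const AE_I2 sum_norm_sq_mult_power_le \<phi> w
            Bochner_Integration.integrable_sum)
          (auto simp: norm_mult)
      finally show ?case .
    qed
  qed simp
qed simp

lemma wcomp_HS_if_bounded:
  assumes hol: "w holomorphic_on ball 0 1" "\<phi> holomorphic_on ball 0 1"
    and \<phi>: "\<And>z. cmod z < 1 \<Longrightarrow> cmod (\<phi> z) < 1"
    and w: "\<And>z. cmod z < 1 \<Longrightarrow> (cmod (w z))\<^sup>2 \<le> 1 - cmod (\<phi> z)"
  shows "wcomp_HS w \<phi>"
proof -
  have hol_comp: "(\<lambda>z. w z * f (\<phi> z)) holomorphic_on ball 0 1" if "hardy2 f" for f
    by (intro holomorphic_intros hol
        holomorphic_on_compose_gen[OF hol(2), unfolded o_def, where t = "ball 0 1"])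
       (use that \<phi> in \<open>auto simp: hardy2_def\<close>)
  have norm_comp_le: "cmod (w z * f (\<phi> z)) \<le> sqrt 2 * h2norm f"
    if f: "hardy2 f" and z: "cmod z < 1" for f z
  proof (rule power2_le_imp_le)
    have "(cmod (w z * f (\<phi> z)))\<^sup>2 \<le> (1 - cmod (\<phi> z)) * (cmod (f (\<phi> z)))\<^sup>2"
      unfolding norm_mult power_mult_distrib by (intro mult_right_mono w z) simp
    also have "\<dots> \<le> (sqrt 2 * h2norm f)\<^sup>2"
      using norm_le_h2norm[OF f \<phi>[OF z]] by (simp add: power_mult_distrib)
    finally show "(cmod (w z * f (\<phi> z)))\<^sup>2 \<le> (sqrt 2 * h2norm f)\<^sup>2" .
  qed (simp add: h2norm_nonneg f)
  have bounded: "hardy2 (\<lambda>z. w z * f (\<phi> z))" "h2norm (\<lambda>z. w z * f (\<phi> z)) \<le> sqrt 2 * h2norm f"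
    if "hardy2 f" for f
    using hardy2_bounded[OF hol_comp[OF that] norm_comp_le[OF that]] by simp_all
  have "summable (\<lambda>n. (h2norm (\<lambda>z. w z * \<phi> z ^ n))\<^sup>2)"
  proof (rule summable_h2norm_mult_power[OF hol \<phi>])
    fix z :: complex assume z: "cmod z < 1"
    have "(cmod (\<phi> z))\<^sup>2 \<le> cmod (\<phi> z)"
      using \<phi>[OF z] by (simp add: power2_eq_square mult_left_le)
    with w[OF z] show "(cmod (w z))\<^sup>2 \<le> 1 - (cmod (\<phi> z))\<^sup>2" by linarith
  qed
  with bounded show ?thesis unfolding wcomp_HS_def by blast
qed

theorem theorem4p1:
  fixes \<phi> :: "complex \<Rightarrow> complex"
  assumes "\<phi> holomorphic_on ball 0 1"
      and "\<phi> ` ball 0 1 \<subseteq> ball 0 1"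
  shows "(\<exists>w. hardy2 w \<and> (\<exists>z\<in>ball 0 1. w z \<noteq> 0) \<and> wcomp_HS w \<phi>)
         \<longleftrightarrow> circle_log_integral \<phi> < \<infinity>"
proof
  have \<phi>: "cmod (\<phi> z) < 1" if "cmod z < 1" for z
    using assms(2) that by (force simp: image_subset_iff)
  {
    assume "\<exists>w. hardy2 w \<and> (\<exists>z\<in>ball 0 1. w z \<noteq> 0) \<and> wcomp_HS w \<phi>"
    then show "circle_log_integral \<phi> < \<infinity>"
      using circle_log_integral_finite_if_HS[OF assms(1) less_imp_le[OF \<phi>]] by auto
  next
    assume fin: "circle_log_integral \<phi> < \<infinity>"
    have h2_\<phi>: "hardy2 \<phi>" by (rule hardy2_bounded(1)[OF assms(1) less_imp_le[OF \<phi>]])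
    obtain w where w: "w holomorphic_on ball 0 1" "w 0 \<noteq> 0"
      "\<And>z. cmod z < 1 \<Longrightarrow> (cmod (w z))\<^sup>2 \<le> 1 - cmod (\<phi> z)"
      using weight_exists[OF h2_\<phi> fin] by blast
    have "cmod (w z) \<le> 1" if "cmod z < 1" for z
      using order.trans[OF w(3)[OF that], of 1] by (simp add: abs_square_le_1)
    then have "hardy2 w" by (rule hardy2_bounded(1)[OF w(1)])
    moreover have "wcomp_HS w \<phi>" by (rule wcomp_HS_if_bounded[OF w(1) assms(1) \<phi> w(3)])
    ultimately show "\<exists>w. hardy2 w \<and> (\<exists>z\<in>ball 0 1. w z \<noteq> 0) \<and> wcomp_HS w \<phi>"
      using w(2) by (metis centre_in_ball zero_less_one)
  }
qed

end
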